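(* Let $T$ be a parallelogram in the Euclidean plane with a dissection into $n$ triangles of areas $a_1,\dots,a_n$. Then $a_n$ is integral over the ring $\mathbb{Z}[a_1,\dots,a_{n-1}]\subset\mathbb{R}$.
   Context: A dissection of a plane polygon $T$ into triangles is a (finite) collection of (nondegenerate) triangles in the plane whose union is $T$ and whose interiors are pairwise disjoint; the triangles are not required to meet edge to edge. Areas here are ordinary (positive) Euclidean areas. $\mathbb{Z}[a_1,\dots,a_{n-1}]$ is the subring of $\mathbb{R}$ generated by $a_1,\dots,a_{n-1}$. *)

theory Defs
  imports "HOL-Analysis.Analysis" "HOL-Computational_Algebra.Polynomial"
begin

definition is_triangle :: "(real ^ 2) set \<Rightarrow> bool" where
  "is_triangle S \<longleftrightarrow> (\<exists>a b c. \<not> collinear {a, b, c} \<and> S = convex hull {a, b, c})"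

definition is_parallelogram :: "(real ^ 2) set \<Rightarrow> bool" where
  "is_parallelogram S \<longleftrightarrow>
     (\<exists>p u v. \<not> collinear {0, u, v} \<and> S = convex hull {p, p + u, p + u + v, p + v})"

text \<open>
  The triangles of a dissection are indexed by \<open>{1..n}\<close>. Nondegenerate triangles have nonempty
  interior, so disjointness of the interiors makes the indexing injective: there are exactly
  \<open>n\<close> triangles.
\<close>

definition dissection :: "(real ^ 2) set \<Rightarrow> nat \<Rightarrow> (nat \<Rightarrow> (real ^ 2) set) \<Rightarrow> bool" where
  "dissection T n t \<longleftrightarrow>
     (\<forall>i\<in>{1..n}. is_triangle (t i)) \<and>
     (\<Union>i\<in>{1..n}. t i) = T \<and>
     (\<forall>i\<in>{1..n}. \<forall>j\<in>{1..n}. i \<noteq> j \<longrightarrow> interior (t i) \<inter> interior (t j) = {})"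

definition area :: "(real ^ 2) set \<Rightarrow> real" where
  "area S = measure lebesgue S"

definition is_subring :: "'a::comm_ring_1 set \<Rightarrow> bool" where
  "is_subring R \<longleftrightarrow> 1 \<in> R \<and> (\<forall>x\<in>R. \<forall>y\<in>R. x - y \<in> R \<and> x * y \<in> R)"

definition subring_generated :: "'a::comm_ring_1 set \<Rightarrow> 'a set" where
  "subring_generated X = is_subring hull X"

text \<open>Same shape as \<^const>\<open>algebraic_int\<close>, which is the case where \<open>R\<close> is the ring of integers.\<close>

definition integral_over :: "'a::comm_ring_1 set \<Rightarrow> 'a \<Rightarrow> bool" where
  "integral_over R x \<longleftrightarrow> (\<exists>p. lead_coeff p = 1 \<and> (\<forall>i. coeff p i \<in> R) \<and> poly p x = 0)"

end

theory Submission
  imports Defs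
begin

text \<open>
  If \<open>a n\<close> is not integral over the subring, some valuation ring \<open>V\<close> of the reals contains the other
  areas but not \<open>a n\<close>, hence not the total area either. In affine coordinates whose origin is a
  corner of the parallelogram, colour the plane as in Monsky's proof: lines carry at most two of the
  three colours, and the area of a rainbow triangle, divided by the total area, is not in the maximal
  ideal of \<open>V\<close>. A Sperner argument yields a rainbow triangle, which must then be the \<open>n\<close>-th one, so one
  of its vertices is congruent to the corner modulo the maximal ideal. The four corners are pairwise
  incongruent, but the triangle has only three vertices.
\<close>

section \<open>Valuation rings\<close>

text \<open>If \<open>x\<close> is not integral over \<open>R\<close>, then \<open>x\<close> is
  missing from \<open>R[1/x]\<close>, and a subring that is maximal among those containing
  \<open>R\<close> and \<open>1/x\<close> but not \<open>x\<close> is a valuation ring. Monsky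
  extends the 2-adic valuation; here the ring is chosen so that the reciprocal of the total area
  falls into the maximal ideal. The obstacle is that triangles need not meet edge to edge, so edges
  cannot be matched in pairs. Sperner's count therefore takes the form of a discrete Stokes
  identity: for a function \<open>\<phi>\<close> of pairs of points that is additive along lines,
  two dissections of the same convex set have the same total of oriented boundary sums. Comparison
  with the two halves of the parallelogram evaluates that total. The signed indicator of a change
  between colours 0 and 1 is such a \<open>\<phi>\<close>, because every line misses a colour, and
  it gives the rainbow triangle. The cross product is another, and it gives additivity of
  area.\<close>

lemma subringD:
  assumes "is_subring S"
  shows "1 \<in> S" "0 \<in> S" "x \<in> S \<Longrightarrow> - x \<in> S"
    "x \<in> S \<Longrightarrow> y \<in> S \<Longrightarrow> x - y \<in> S"
    "x \<in> S \<Longrightarrow> y \<in> S \<Longrightarrow> x + y \<in> S"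
    "x \<in> S \<Longrightarrow> y \<in> S \<Longrightarrow> x * y \<in> S"
proof -
  show 1: "1 \<in> S" using assms by (simp add: is_subring_def)
  show d: "x - y \<in> S" if "x \<in> S" "y \<in> S" for x y
    using assms that by (auto simp: is_subring_def)
  show 0: "0 \<in> S" using d[OF 1 1] by simp
  show n: "- x \<in> S" if "x \<in> S" for x using d[OF 0 that] by simp
  show "x + y \<in> S" if "x \<in> S" "y \<in> S" using d[OF that(1) n[OF that(2)]] by simp
  show "x * y \<in> S" if "x \<in> S" "y \<in> S" using assms that by (auto simp: is_subring_def)
qed

lemma subring_sum:
  assumes "is_subring S" "\<And>i. i \<in> I \<Longrightarrow> f i \<in> S"
  shows "sum f I \<in> S"
  using assms(2) by (induction I rule: infinite_finite_induct) (auto simp: subringD[OF assms(1)])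

lemma subring_power:
  assumes "is_subring S" "x \<in> S"
  shows "x ^ n \<in> S"
  using assms by (induction n) (auto simp: subringD)

section \<open>Adjoining an element to a subring, with and without a degree bound\<close>

definition adjoin :: "'a::comm_ring_1 set \<Rightarrow> 'a \<Rightarrow> 'a set" where
  "adjoin S z = {poly p z | p. \<forall>i. coeff p i \<in> S}"

lemma is_subring_adjoin:
  assumes S: "is_subring S"
  shows "is_subring (adjoin S z)"
  unfolding is_subring_def
proof (intro conjI ballI)
  show "1 \<in> adjoin S z"
    unfolding adjoin_def using subringD[OF S] by (auto intro!: exI[of _ 1] simp: coeff_1)
  fix x y assume "x \<in> adjoin S z" "y \<in> adjoin S z"
  then obtain p q where pq: "x = poly p z" "y = poly q z" "\<And>i. coeff p i \<in> S" "\<And>i. coeff q i \<in> S"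
    by (auto simp: adjoin_def)
  show "x - y \<in> adjoin S z"
    unfolding adjoin_def using pq subringD[OF S] by (auto intro!: exI[of _ "p - q"])
  show "x * y \<in> adjoin S z"
    unfolding adjoin_def using pq subringD[OF S]
    by (auto intro!: exI[of _ "p * q"] subring_sum[OF S] simp: coeff_mult)
qed

lemma subset_adjoin:
  assumes "is_subring S"
  shows "S \<subseteq> adjoin S z"
proof
  fix x assume "x \<in> S"
  then show "x \<in> adjoin S z"
    unfolding adjoin_def using subringD[OF assms]
    by (auto intro!: exI[of _ "[:x:]"] simp: coeff_pCons split: nat.split)
qed

lemma in_adjoin:
  assumes "is_subring S"
  shows "z \<in> adjoin S z"
  unfolding adjoin_def using subringD[OF assms]
  by (auto intro!: exI[of _ "[:0, 1:]"] simp: coeff_pCons split: nat.split)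

text \<open>Unlike \<open>adjoin\<close>, this records a bound on the degree (less than
  \<open>k\<close>), because the valuation ring argument compares minimal degrees in
  \<open>z\<close> and in \<open>inverse z\<close>.\<close>

definition poly_values :: "'a::comm_ring_1 set \<Rightarrow> 'a \<Rightarrow> nat \<Rightarrow> 'a set" where
  "poly_values S z k = {\<Sum>i<k. c i * z ^ i | c. \<forall>i. c i \<in> S}"

lemma adjoin_poly_values:
  assumes "x \<in> adjoin S z"
  obtains k where "x \<in> poly_values S z k"
proof -
  obtain p where p: "x = poly p z" "\<forall>i. coeff p i \<in> S"
    using assms by (auto simp: adjoin_def)
  then have "x = (\<Sum>i<Suc (degree p). coeff p i * z ^ i)"
    unfolding lessThan_Suc_atMost by (simp add: poly_altdef)
  then have "x \<in> poly_values S z (Suc (degree p))"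
    unfolding poly_values_def using p(2) by blast
  then show thesis by (rule that)
qed

lemma poly_values_0 [simp]: "poly_values S z 0 = (if S = {} then {} else {0})"
  by (auto simp: poly_values_def)

lemma poly_values_add:
  assumes S: "is_subring S" and "x \<in> poly_values S z k" "y \<in> poly_values S z k"
  shows "x + y \<in> poly_values S z k"
proof -
  obtain c d where cd: "x = (\<Sum>i<k. c i * z ^ i)" "y = (\<Sum>i<k. d i * z ^ i)"
    "\<And>i. c i \<in> S" "\<And>i. d i \<in> S"
    using assms by (auto simp: poly_values_def)
  then show ?thesis
    unfolding poly_values_def
    by (auto intro!: exI[of _ "\<lambda>i. c i + d i"] simp: subringD[OF S] sum.distrib distrib_right)
qed

lemma poly_values_mult:
  assumes S: "is_subring S" and "x \<in> poly_values S z k" "y \<in> S"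
  shows "y * x \<in> poly_values S z k"
proof -
  obtain c where c: "x = (\<Sum>i<k. c i * z ^ i)" "\<And>i. c i \<in> S"
    using assms by (auto simp: poly_values_def)
  then show ?thesis
    unfolding poly_values_def using assms(3)
    by (auto intro!: exI[of _ "\<lambda>i. y * c i"] simp: subringD[OF S] sum_distrib_left mult.assoc)
qed

lemma power_in_poly_values:
  assumes S: "is_subring S" and "i < k"
  shows "z ^ i \<in> poly_values S z k"
proof -
  have "z ^ i = (\<Sum>j<k. (if j = i then 1 else 0) * z ^ j)"
    using \<open>i < k\<close> by (simp add: if_distrib[of "\<lambda>u. u * _"] cong: if_cong)
  then show ?thesis
    unfolding poly_values_def using subringD[OF S]
    by (intro CollectI exI[of _ "\<lambda>j. if j = i then 1 else 0"]) auto
qed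

lemma poly_values_sum:
  assumes S: "is_subring S" and "\<And>i. i \<in> I \<Longrightarrow> f i \<in> poly_values S z k"
  shows "sum f I \<in> poly_values S z k"
proof -
  have "0 \<in> poly_values S z k"
    unfolding poly_values_def by (auto intro!: exI[of _ "\<lambda>_. 0"] simp: subringD[OF S])
  then show ?thesis
    using assms(2) by (induction I rule: infinite_finite_induct) (auto simp: poly_values_add[OF S])
qed

lemma poly_values_Suc:
  assumes "x \<in> poly_values S z (Suc k)" and S: "is_subring S"
  obtains y c where "x = y + c * z ^ k" "c \<in> S" "y \<in> poly_values S z k"
  using assms unfolding poly_values_def by auto

text \<open>The degree-lowering step of Chevalley's extension theorem. Multiplying the expression in
  \<open>inverse z\<close> by \<open>y = 1/x\<close> turns its value into 1; collecting the constant
  term gives the unit \<open>1 - y * d 0\<close>, and scaling by \<open>z ^ n\<close> expresses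
  \<open>z ^ n\<close> through lower powers, none of them negative since \<open>m \<le> n\<close>.
  This replaces the top term of the expression in \<open>z\<close>.\<close>

lemma poly_values_reduce:
  fixes z :: "'a::field"
  assumes S: "is_subring S"
    and units: "\<And>s. s \<in> S \<Longrightarrow> inverse (1 - y * s) \<in> S \<and> 1 - y * s \<noteq> 0"
    and y: "y \<in> S" "x * y = 1" and z: "z \<noteq> 0"
    and n: "x \<in> poly_values S z (Suc n)" and m: "x \<in> poly_values S (inverse z) (Suc m)"
    and "m \<le> n"
  shows "x \<in> poly_values S z n"
proof -
  obtain d where d: "x = (\<Sum>j<Suc m. d j * inverse z ^ j)" "\<And>j. d j \<in> S"
    using m by (auto simp: poly_values_def)
  define w where "w = inverse (1 - y * d 0)"
  have w: "w \<in> S" "w * (1 - y * d 0) = 1"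
    using units[OF d(2)[of 0]] by (auto simp: w_def)
  have "1 = y * d 0 + y * (\<Sum>j<m. d (Suc j) * inverse z ^ Suc j)"
    using y(2) unfolding d(1) sum.lessThan_Suc_shift by (simp add: algebra_simps)
  then have "1 - y * d 0 = y * (\<Sum>j<m. d (Suc j) * inverse z ^ Suc j)" by (simp add: algebra_simps)
  then have "1 = w * (y * (\<Sum>j<m. d (Suc j) * inverse z ^ Suc j))" using w(2) by simp
  then have "z ^ n = w * (y * (\<Sum>j<m. d (Suc j) * (inverse z ^ Suc j * z ^ n)))"
    by (metis (no_types, lifting) mult.assoc mult_1 sum.cong sum_distrib_right)
  also have "(\<Sum>j<m. d (Suc j) * (inverse z ^ Suc j * z ^ n)) = (\<Sum>j<m. d (Suc j) * z ^ (n - Suc j))"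
    using z \<open>m \<le> n\<close> by (intro sum.cong refl) (auto simp: power_diff field_simps)
  finally have zn: "z ^ n = w * (y * (\<Sum>j<m. d (Suc j) * z ^ (n - Suc j)))" .
  have "z ^ n \<in> poly_values S z n"
    unfolding zn using \<open>m \<le> n\<close>
    by (intro poly_values_mult[OF S] poly_values_sum[OF S] power_in_poly_values[OF S] w y d(2)) auto
  then show ?thesis
    using n by (elim poly_values_Suc[OF _ S]) (auto intro!: poly_values_add[OF S] poly_values_mult[OF S])
qed

definition valuation_ring :: "'a::field set \<Rightarrow> bool" where
  "valuation_ring V \<longleftrightarrow> is_subring V \<and> (\<forall>x. x \<in> V \<or> inverse x \<in> V)"

text \<open>By maximality, adjoining any element outside \<open>S\<close> brings in
  \<open>x\<close>. Hence each \<open>1 - y * s\<close> is a unit, that is,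
  \<open>y = inverse x\<close> lies in the Jacobson radical. If neither \<open>z\<close> nor
  \<open>inverse z\<close> were in \<open>S\<close>, the longer of the two minimal expressions for
  \<open>x\<close> could be shortened by means of the other.\<close>

lemma maximal_subring_valuation_ring:
  fixes x :: "'a::field"
  assumes S: "is_subring S" and y: "inverse x \<in> S" and x: "x \<notin> S"
    and max: "\<And>S'. is_subring S' \<Longrightarrow> S \<subseteq> S' \<Longrightarrow> x \<notin> S' \<Longrightarrow> S' = S"
  shows "valuation_ring S"
proof -
  note SD = subringD[OF S]
  define y where "y = inverse x"
  have "x \<noteq> 0" using x SD by auto
  then have yx: "y \<in> S" "x * y = 1" using y by (auto simp: y_def)
  have adj: "x \<in> adjoin S z" if "z \<notin> S" for z
    using max[OF is_subring_adjoin[OF S] subset_adjoin[OF S]] in_adjoin[OF S, of z] that by blast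
  have units: "inverse (1 - y * s) \<in> S \<and> 1 - y * s \<noteq> 0" if s: "s \<in> S" for s
  proof -
    define u where "u = 1 - y * s"
    have u: "u \<in> S" using s yx SD by (auto simp: u_def)
    have "u \<noteq> 0"
    proof
      assume "u = 0"
      then have "x = x * (y * s)" by (simp add: u_def)
      also have "\<dots> = s" using yx by (simp flip: mult.assoc)
      finally show False using s x by simp
    qed
    moreover have "inverse u \<in> S"
    proof (rule ccontr)
      assume "inverse u \<notin> S"
      from adj[OF this] obtain k where "x \<in> poly_values S (inverse u) k"
        by (rule adjoin_poly_values)
      then obtain c where c: "x = (\<Sum>i<k. c i * inverse u ^ i)" "\<And>i. c i \<in> S"
        by (auto simp: poly_values_def)
      \<comment> \<open>Clearing denominators puts \<open>x * u ^ k\<close> into \<open>S\<close>.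
        As \<open>u\<close> is 1 modulo \<open>y\<close>, also \<open>x * (1 - u ^ k)\<close> lies
        in \<open>S\<close>, and the two add up to \<open>x\<close>.\<close>
      have "x * u ^ k = (\<Sum>i<k. c i * u ^ (k - i))"
        unfolding c(1) sum_distrib_right using \<open>u \<noteq> 0\<close>
        by (intro sum.cong refl) (auto simp: power_diff field_simps)
      then have xu: "x * u ^ k \<in> S"
        using c(2) u by (auto intro!: subring_sum[OF S] SD subring_power[OF S])
      have "\<exists>r\<in>S. 1 - u ^ j = y * r" for j
      proof (induction j)
        case 0 then show ?case using SD by auto
      next
        case (Suc j)
        then obtain r where r: "r \<in> S" "1 - u ^ j = y * r" by auto
        have "1 - u ^ Suc j = (1 - u) + u * (1 - u ^ j)" by (simp add: algebra_simps)
        also have "\<dots> = y * (s + u * r)" unfolding r(2) by (simp add: u_def algebra_simps)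
        finally show ?case using r(1) s u by (intro bexI[of _ "s + u * r"] SD)
      qed
      then obtain r where r: "r \<in> S" "1 - u ^ k = y * r" by auto
      have "x = x * u ^ k + x * (1 - u ^ k)" by (simp add: algebra_simps)
      also have "x * (1 - u ^ k) = r" unfolding r(2) using yx by (simp flip: mult.assoc)
      finally show False using SD(5)[OF xu r(1)] x by simp
    qed
    ultimately show ?thesis by (simp add: u_def)
  qed
  have "z \<in> S \<or> inverse z \<in> S" for z
  proof (rule ccontr)
    assume z: "\<not> (z \<in> S \<or> inverse z \<in> S)"
    then have "z \<noteq> 0" using SD by auto
    have ex: "\<exists>k. x \<in> poly_values S z (Suc k)" if z: "z \<notin> S" for z
    proof -
      obtain k where k: "x \<in> poly_values S z k" using adjoin_poly_values[OF adj[OF z]] .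
      with x SD(2) have "k \<noteq> 0" by (intro notI) (auto split: if_splits)
      with k show ?thesis by (metis not0_implies_Suc)
    qed
    \<comment> \<open>The \<open>Suc\<close> turns a number of terms into a degree. In degree 0 the
      set \<open>poly_values S z (N z)\<close> is \<open>{0}\<close>, which also excludes
      \<open>x\<close>.\<close>
    define N where "N z = (LEAST k. x \<in> poly_values S z (Suc k))" for z
    have N: "x \<in> poly_values S z (Suc (N z))" if "z \<notin> S" for z
      unfolding N_def using ex[OF that] by (rule LeastI_ex)
    have N': "\<not> x \<in> poly_values S z (N z)" if "z \<notin> S" for z
    proof (cases "N z")
      case 0 then show ?thesis using x SD(2) by auto
    next
      case (Suc k)
      then show ?thesis using not_less_Least[of k "\<lambda>k. x \<in> poly_values S z (Suc k)"]
        by (auto simp: N_def)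
    qed
    show False
    proof (cases "N (inverse z) \<le> N z")
      case True
      from poly_values_reduce[OF S units yx \<open>z \<noteq> 0\<close> N N True] z N'[of z] show False by auto
    next
      case False
      then have "N (inverse (inverse z)) \<le> N (inverse z)" by simp
      from poly_values_reduce[OF S units yx _ N N this] z N'[of "inverse z"] \<open>z \<noteq> 0\<close>
      show False by auto
    qed
  qed
  with S show ?thesis by (auto simp: valuation_ring_def)
qed

text \<open>Multiplying an expression of \<open>x\<close> through powers of \<open>inverse x\<close>
  by \<open>x ^ k\<close> produces a monic equation of degree \<open>k + 1\<close>.\<close>

lemma integral_if_in_adjoin_inverse:
  fixes x :: "'a::field"
  assumes R: "is_subring R" and x: "x \<noteq> 0" "x \<in> adjoin R (inverse x)"
  shows "integral_over R x"
proof -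
  obtain k where "x \<in> poly_values R (inverse x) k" using x(2) by (rule adjoin_poly_values)
  then obtain c where c: "x = (\<Sum>i<k. c i * inverse x ^ i)" "\<And>i. c i \<in> R"
    by (auto simp: poly_values_def)
  define q where "q = (\<Sum>i<k. monom (c i) (k - i))"
  define p where "p = monom 1 (Suc k) - q"
  have coq: "coeff q j = 0" if "k < j" for j
    unfolding q_def coeff_sum using that by (intro sum.neutral) auto
  have "degree p \<le> Suc k" using coq by (intro degree_le) (auto simp: p_def)
  moreover have "coeff p (Suc k) = 1" using coq by (simp add: p_def)
  ultimately have "lead_coeff p = 1" by (metis le_antisym le_degree zero_neq_one)
  moreover have "coeff p i \<in> R" for i
    unfolding p_def q_def
    by (auto simp: coeff_sum intro!: subringD[OF R] subring_sum[OF R] c(2))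
  moreover have "poly p x = 0"
  proof -
    have "x ^ Suc k = (\<Sum>i<k. c i * inverse x ^ i) * x ^ k" by (subst c(1)[symmetric]) simp
    also have "\<dots> = (\<Sum>i<k. c i * x ^ (k - i))"
      unfolding sum_distrib_right using x
      by (intro sum.cong refl) (auto simp: power_diff field_simps)
    finally show ?thesis by (simp add: p_def q_def poly_sum poly_monom)
  qed
  ultimately show ?thesis unfolding integral_over_def by blast
qed

text \<open>Zorn's lemma for the subrings that contain \<open>R\<close> and \<open>inverse x\<close>
  but not \<open>x\<close>; \<open>adjoin R (inverse x)\<close> is one of them because
  \<open>x\<close> is not integral.\<close>

lemma exists_valuation_ring:
  fixes x :: "'a::field"
  assumes R: "is_subring R" and x: "\<not> integral_over R x"
  obtains V where "valuation_ring V" "R \<subseteq> V" "x \<notin> V"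
proof -
  have "integral_over R 0"
    unfolding integral_over_def using subringD[OF R]
    by (intro exI[of _ "[:0, 1:]"]) (auto simp: coeff_pCons split: nat.split)
  with x have "x \<noteq> 0" by auto
  define \<A> where "\<A> = {S. is_subring S \<and> R \<subseteq> S \<and> inverse x \<in> S \<and> x \<notin> S}"
  have "adjoin R (inverse x) \<in> \<A>"
    using integral_if_in_adjoin_inverse[OF R \<open>x \<noteq> 0\<close>] x
      is_subring_adjoin[OF R] subset_adjoin[OF R] in_adjoin[OF R] by (auto simp: \<A>_def)
  then have "\<A> \<noteq> {}" by blast
  have "\<Union>\<C> \<in> \<A>" if \<C>: "\<C> \<noteq> {}" "subset.chain \<A> \<C>" for \<C>
  proof -
    have \<C>\<A>: "\<C> \<subseteq> \<A>" using \<C>(2) by (simp add: subset.chain_def)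
    obtain S where "S \<in> \<C>" using \<C>(1) by auto
    with \<C>\<A> have "1 \<in> S" "R \<subseteq> S" "inverse x \<in> S" by (auto simp: \<A>_def subringD(1))
    then have "1 \<in> \<Union>\<C>" "R \<subseteq> \<Union>\<C>" "inverse x \<in> \<Union>\<C>" using \<open>S \<in> \<C>\<close> by auto
    moreover have "x \<notin> \<Union>\<C>" using \<C>\<A> by (auto simp: \<A>_def)
    moreover have "a - b \<in> \<Union>\<C> \<and> a * b \<in> \<Union>\<C>" if ab: "a \<in> \<Union>\<C>" "b \<in> \<Union>\<C>" for a b
    proof -
      obtain A B where AB: "A \<in> \<C>" "a \<in> A" "B \<in> \<C>" "b \<in> B" using ab by auto
      have "A \<subseteq> B \<or> B \<subseteq> A" using \<C>(2) AB by (auto simp: subset.chain_def)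
      then obtain D where D: "D \<in> \<C>" "a \<in> D" "b \<in> D" using AB by blast
      then have "is_subring D" using \<C>\<A> by (auto simp: \<A>_def)
      then have "a - b \<in> D" "a * b \<in> D" using D by (auto simp: subringD)
      then show ?thesis using D(1) by blast
    qed
    ultimately show ?thesis by (auto simp: \<A>_def is_subring_def)
  qed
  from subset_Zorn_nonempty[OF \<open>\<A> \<noteq> {}\<close> this]
  obtain M where M: "M \<in> \<A>" "\<forall>X\<in>\<A>. M \<subseteq> X \<longrightarrow> X = M" by blast
  have "valuation_ring M"
    using M by (intro maximal_subring_valuation_ring[of M x]) (auto simp: \<A>_def)
  with M show thesis by (intro that[of M]) (auto simp: \<A>_def)
qed

section \<open>Sections of triangles by lines\<close>

text \<open>The one-dimensional model of cancellation across common edges: each interval ends where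
  the next one starts, so arbitrary \<open>f\<close> telescopes. The induction removes the interval
  that starts at \<open>l\<close>.\<close>

lemma interval_sum_telescope:
  fixes f :: "real \<Rightarrow> real" and \<alpha> \<beta> :: "'i \<Rightarrow> real"
  assumes "finite I" "\<And>i. i \<in> I \<Longrightarrow> \<alpha> i < \<beta> i" "l < h"
    and "\<And>i j. i \<in> I \<Longrightarrow> j \<in> I \<Longrightarrow> i \<noteq> j \<Longrightarrow> {\<alpha> i<..<\<beta> i} \<inter> {\<alpha> j<..<\<beta> j} = {}"
    and "(\<Union>i\<in>I. {\<alpha> i..\<beta> i}) = {l..h}"
  shows "(\<Sum>i\<in>I. f (\<alpha> i) - f (\<beta> i)) = f l - f h"
  using assms
proof (induction "card I" arbitrary: I l)
  case 0
  then show ?case by auto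
next
  case (Suc n)
  note fin = Suc.prems(1) and lt = Suc.prems(2) and disj = Suc.prems(4) and un = Suc.prems(5)
  have sub: "l \<le> \<alpha> i" "\<beta> i \<le> h" if "i \<in> I" for i
  proof -
    have "{\<alpha> i..\<beta> i} \<subseteq> {l..h}" using un that by blast
    then show "l \<le> \<alpha> i" "\<beta> i \<le> h" using lt[OF that] by auto
  qed
  have "l \<in> (\<Union>i\<in>I. {\<alpha> i..\<beta> i})" using un \<open>l < h\<close> by auto
  then obtain i where i: "i \<in> I" "\<alpha> i = l" using sub by (auto intro: antisym)
  define J where "J = I - {i}"
  have J: "finite J" "card J = n" using fin Suc.hyps(2) i by (auto simp: J_def)
  have sumI: "(\<Sum>j\<in>I. f (\<alpha> j) - f (\<beta> j)) = f l - f (\<beta> i) + (\<Sum>j\<in>J. f (\<alpha> j) - f (\<beta> j))"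
    using fin i by (simp add: J_def sum.remove[of I i])
  have right: "\<beta> i \<le> \<alpha> j" if "j \<in> J" for j
  proof (rule ccontr)
    assume less: "\<not> \<beta> i \<le> \<alpha> j"
    have "j \<in> I" "j \<noteq> i" using that by (auto simp: J_def)
    obtain y where "\<alpha> j < y" "y < min (\<beta> i) (\<beta> j)"
      using lt[OF \<open>j \<in> I\<close>] less dense[of "\<alpha> j" "min (\<beta> i) (\<beta> j)"] by auto
    then have "y \<in> {\<alpha> i<..<\<beta> i} \<inter> {\<alpha> j<..<\<beta> j}"
      using sub(1)[OF \<open>j \<in> I\<close>] i by auto
    then show False using disj[of i j] i \<open>j \<in> I\<close> \<open>j \<noteq> i\<close> by auto
  qed
  show ?case
  proof (cases "\<beta> i = h")
    case True
    have "J = {}"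
    proof (rule ccontr)
      assume "J \<noteq> {}"
      then obtain j where "j \<in> J" by auto
      then have "j \<in> I" by (simp add: J_def)
      then show False using right[OF \<open>j \<in> J\<close>] lt[OF \<open>j \<in> I\<close>] sub(2)[OF \<open>j \<in> I\<close>] True by simp
    qed
    then show ?thesis using sumI True by simp
  next
    case False
    then have "\<beta> i < h" using sub(2)[OF i(1)] by simp
    have half: "y \<in> (\<Union>j\<in>J. {\<alpha> j..\<beta> j})" if "y \<in> {\<beta> i<..h}" for y
    proof -
      have "y \<in> {l..h}" using that lt[OF i(1)] i(2) by auto
      with un obtain j where "j \<in> I" "y \<in> {\<alpha> j..\<beta> j}" by blast
      moreover have "j \<noteq> i" using calculation that by auto
      ultimately show ?thesis by (auto simp: J_def)
    qed
    \<comment> \<open>The other intervals are so far known to cover only the half-open rest; their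
      union is closed, so it contains the left end \<open>\<beta> i\<close> too.\<close>
    have "closed (\<Union>j\<in>J. {\<alpha> j..\<beta> j})" using J by (intro closed_UN) auto
    then have "closure {\<beta> i<..h} \<subseteq> (\<Union>j\<in>J. {\<alpha> j..\<beta> j})"
      using half by (intro closure_minimal) auto
    then have "{\<beta> i..h} \<subseteq> (\<Union>j\<in>J. {\<alpha> j..\<beta> j})" using \<open>\<beta> i < h\<close> by simp
    moreover have "(\<Union>j\<in>J. {\<alpha> j..\<beta> j}) \<subseteq> {\<beta> i..h}"
    proof
      fix y assume "y \<in> (\<Union>j\<in>J. {\<alpha> j..\<beta> j})"
      then obtain j where "j \<in> J" "y \<in> {\<alpha> j..\<beta> j}" by auto
      then show "y \<in> {\<beta> i..h}" using right[of j] sub(2)[of j] by (auto simp: J_def)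
    qed
    ultimately have eq: "(\<Union>j\<in>J. {\<alpha> j..\<beta> j}) = {\<beta> i..h}" by blast
    have "(\<Sum>j\<in>J. f (\<alpha> j) - f (\<beta> j)) = f (\<beta> i) - f h"
      using J lt disj \<open>\<beta> i < h\<close> eq by (intro Suc.hyps(1)) (auto simp: J_def)
    then show ?thesis using sumI by simp
  qed
qed

text \<open>In coordinates \<open>P + v (Q - P) + w (R - P)\<close> the line \<open>X = t\<close>
  has the equation \<open>v / \<kappa> + w / \<mu> = 1\<close>. Since \<open>\<kappa>\<close> and
  \<open>\<mu>\<close> are below 1, \<open>v + w < 1\<close> holds along the whole segment from
  \<open>N\<close> to \<open>M\<close>, so the third side is not reached.\<close>

lemma fiber_triangle:
  fixes P Q R :: "real ^ 2" and X :: "real ^ 2 \<Rightarrow> real"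
  assumes X: "linear X" and nc: "\<not> collinear {P, Q, R}"
    and l: "0 < \<kappa>" "\<kappa> < 1" "0 < \<mu>" "\<mu> < 1" and t: "t \<noteq> X P"
    and eq: "\<kappa> * (X Q - X P) = t - X P" "\<mu> * (X R - X P) = t - X P"
  defines "N \<equiv> P + \<kappa> *\<^sub>R (Q - P)" and "M \<equiv> P + \<mu> *\<^sub>R (R - P)"
  shows "X N = t" "X M = t" "N \<noteq> M"
    "z \<in> convex hull {P, Q, R} \<and> X z = t \<longleftrightarrow> z \<in> closed_segment N M"
    "z \<in> open_segment N M \<Longrightarrow> z \<in> interior (convex hull {P, Q, R})"
proof -
  interpret X: linear X by (rule X)
  show XN: "X N = t" and XM: "X M = t"
    using eq by (simp_all add: N_def M_def X.add X.diff X.scaleR)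
  have XZ: "X (P + v *\<^sub>R (Q - P) + w *\<^sub>R (R - P)) = X P + (v / \<kappa> + w / \<mu>) * (t - X P)" for v w
  proof -
    have "X Q - X P = (t - X P) / \<kappa>" "X R - X P = (t - X P) / \<mu>"
      using eq l by (simp_all add: field_simps)
    then show ?thesis by (simp add: X.add X.diff X.scaleR distrib_right)
  qed
  have comb: "(1 - u) *\<^sub>R N + u *\<^sub>R M = P + (\<kappa> * (1 - u)) *\<^sub>R (Q - P) + (\<mu> * u) *\<^sub>R (R - P)" for u
    by (simp add: N_def M_def algebra_simps)
  have bary: "x *\<^sub>R P + y *\<^sub>R Q + z *\<^sub>R R = P + y *\<^sub>R (Q - P) + z *\<^sub>R (R - P)" if "x + y + z = 1" for x y z
  proof -
    have "x = 1 - y - z" using that by simp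
    then show ?thesis unfolding \<open>x = 1 - y - z\<close> by (simp add: algebra_simps)
  qed
  have lt1: "\<kappa> * (1 - u) + \<mu> * u < 1" if "0 \<le> u" "u \<le> 1" for u
  proof -
    have "\<kappa> * (1 - u) + \<mu> * u \<le> max \<kappa> \<mu> * (1 - u) + max \<kappa> \<mu> * u"
      using that by (intro add_mono mult_right_mono) auto
    also have "\<dots> = max \<kappa> \<mu>" by (simp add: algebra_simps)
    also have "\<dots> < 1" using l by simp
    finally show ?thesis .
  qed
  show "N \<noteq> M"
  proof
    assume "N = M"
    then have "\<kappa> *\<^sub>R (Q - P) = \<mu> *\<^sub>R (R - P)" by (simp add: N_def M_def)
    then have "inverse \<mu> *\<^sub>R (\<kappa> *\<^sub>R (Q - P)) = inverse \<mu> *\<^sub>R (\<mu> *\<^sub>R (R - P))" by simp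
    then have "R - P = (inverse \<mu> * \<kappa>) *\<^sub>R (Q - P)" using l by simp
    then have "collinear {Q, P, R}" using collinear_3[of Q P R] by (auto simp: collinear_lemma)
    then show False using nc by (simp add: insert_commute)
  qed
  show "z \<in> convex hull {P, Q, R} \<and> X z = t \<longleftrightarrow> z \<in> closed_segment N M"
  proof
    assume "z \<in> convex hull {P, Q, R} \<and> X z = t"
    then obtain v w where vw: "z = P + v *\<^sub>R (Q - P) + w *\<^sub>R (R - P)" "0 \<le> v" "0 \<le> w" "X z = t"
      unfolding convex_hull_3_alt by auto
    then have "X P + (v / \<kappa> + w / \<mu>) * (t - X P) = t" using XZ[of v w] by simp
    then have "(v / \<kappa> + w / \<mu> - 1) * (t - X P) = 0" by (simp add: algebra_simps)
    then have s: "v / \<kappa> = 1 - w / \<mu>" using t by simp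
    then have "z = (1 - w / \<mu>) *\<^sub>R N + (w / \<mu>) *\<^sub>R M"
      unfolding comb vw(1) using l by (simp flip: s)
    moreover have "0 \<le> v / \<kappa>" "0 \<le> w / \<mu>" using vw l by simp_all
    moreover from this have "w / \<mu> \<le> 1" using s by linarith
    ultimately show "z \<in> closed_segment N M" unfolding closed_segment_def by blast
  next
    assume "z \<in> closed_segment N M"
    then obtain u where u: "z = (1 - u) *\<^sub>R N + u *\<^sub>R M" "0 \<le> u" "u \<le> 1"
      by (auto simp: closed_segment_def)
    have "X z = t" unfolding u(1) X.add X.scaleR XN XM by (simp add: algebra_simps)
    moreover have "z \<in> convex hull {P, Q, R}"
      unfolding convex_hull_3_alt u(1) comb using u l lt1[OF u(2,3)]
      by (intro CollectI exI[of _ "\<kappa> * (1 - u)"] exI[of _ "\<mu> * u"]) auto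
    ultimately show "z \<in> convex hull {P, Q, R} \<and> X z = t" by simp
  qed
  show "z \<in> interior (convex hull {P, Q, R})" if z: "z \<in> open_segment N M"
  proof -
    obtain u where u: "z = (1 - u) *\<^sub>R N + u *\<^sub>R M" "0 < u" "u < 1"
      using z by (auto simp: in_segment)
    have "DIM(real ^ 2) = 2" by simp
    then show ?thesis
      unfolding interior_convex_hull_3_minimal[OF nc \<open>DIM(real ^ 2) = 2\<close>]
      using bary[of "1 - \<kappa> * (1 - u) - \<mu> * u" "\<kappa> * (1 - u)" "\<mu> * u"] comb[of u] u l lt1[of u]
      by (intro CollectI exI[of _ "1 - \<kappa> * (1 - u) - \<mu> * u"] exI[of _ "\<kappa> * (1 - u)"] exI[of _ "\<mu> * u"])
        auto
  qed
qed

text \<open>The line through \<open>u\<close> and \<open>v\<close> as a graph over \<open>X\<close>.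
  With \<open>t\<close> as last argument, equality of the functions \<open>edge_at X u v\<close> is
  equality of lines on which \<open>X\<close> is not constant; overlapping edges of different
  triangles are identified in this way.\<close>

definition edge_at :: "(real ^ 2 \<Rightarrow> real) \<Rightarrow> real ^ 2 \<Rightarrow> real ^ 2 \<Rightarrow> real \<Rightarrow> real ^ 2" where
  "edge_at X u v t = u + ((t - X u) / (X v - X u)) *\<^sub>R (v - u)"

lemma edge_at_endpoints:
  assumes "X u \<noteq> X v"
  shows "edge_at X u v (X u) = u" "edge_at X u v (X v) = v"
  using assms by (simp_all add: edge_at_def)

lemma edge_at_commute:
  assumes "X u \<noteq> X v"
  shows "edge_at X u v t = edge_at X v u t"
proof -
  define c where "c = (t - X u) / (X v - X u)"
  have c': "(t - X v) / (X u - X v) = 1 - c" using assms by (simp add: c_def field_simps)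
  show ?thesis unfolding edge_at_def c' c_def[symmetric] by (simp add: algebra_simps)
qed

lemma linear_edge_at:
  assumes "linear X" "X u \<noteq> X v"
  shows "X (edge_at X u v t) = t"
proof -
  interpret linear X by fact
  show ?thesis using assms(2) by (simp add: edge_at_def add diff scaleR)
qed

lemma collinear_edge_at: "collinear {edge_at X u v r, edge_at X u v s, edge_at X u v t}"
proof -
  have "\<exists>c. edge_at X u v a - edge_at X u v b = c *\<^sub>R (v - u)" for a b
    by (auto simp: edge_at_def simp flip: scaleR_diff_left)
  then show ?thesis unfolding collinear_def by (intro exI[of _ "v - u"]) blast
qed

text \<open>Both functions are affine in \<open>t\<close>, so two values determine them. Hence
  distinct edge lines cross over at most one abscissa.\<close>

lemma edge_at_eqI:
  assumes "edge_at X u v r = edge_at X u' v' r" "edge_at X u v s = edge_at X u' v' s" "r \<noteq> s"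
  shows "edge_at X u v = edge_at X u' v'"
proof
  fix t
  have "edge_at X a b t = edge_at X a b r + ((t - r) / (s - r)) *\<^sub>R (edge_at X a b s - edge_at X a b r)" for a b
  proof -
    have "(t - r) / (s - r) * ((s - X a) / (X b - X a) - (r - X a) / (X b - X a)) = (t - r) / (X b - X a)"
      using \<open>r \<noteq> s\<close> by (simp flip: diff_divide_distrib)
    then have "((t - r) / (s - r)) *\<^sub>R (edge_at X a b s - edge_at X a b r) = ((t - r) / (X b - X a)) *\<^sub>R (b - a)"
      by (simp add: edge_at_def flip: scaleR_diff_left)
    then show ?thesis by (simp add: edge_at_def add_divide_distrib diff_divide_distrib flip: scaleR_add_left)
  qed
  then show "edge_at X u v t = edge_at X u' v' t" using assms(1,2) by metis
qed

text \<open>Twice the signed area, positive for counterclockwise order.\<close>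

definition det3 :: "real ^ 2 \<Rightarrow> real ^ 2 \<Rightarrow> real ^ 2 \<Rightarrow> real" where
  "det3 p q r = (q $ 1 - p $ 1) * (r $ 2 - p $ 2) - (r $ 1 - p $ 1) * (q $ 2 - p $ 2)"

text \<open>An abscissa with a free parameter \<open>s\<close>, chosen later so that all vertices
  have different abscissas and no edge is vertical.\<close>

definition shear :: "real \<Rightarrow> real ^ 2 \<Rightarrow> real" where
  "shear s p = p $ 1 + s * p $ 2"

definition fiber_point :: "real \<Rightarrow> real \<Rightarrow> real \<Rightarrow> real ^ 2" where
  "fiber_point s t y = vector [t - s * y, y]"

lemma linear_shear: "linear (shear s)"
  by (rule linearI) (simp_all add: shear_def algebra_simps)

lemma fiber_point_nth [simp]: "fiber_point s t y $ 2 = y" "shear s (fiber_point s t y) = t"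
  by (simp_all add: fiber_point_def shear_def)

lemma fiber_point_shear: "shear s p = t \<Longrightarrow> fiber_point s t (p $ 2) = p"
  by (auto simp: fiber_point_def shear_def vec_eq_iff forall_2)

lemma fiber_point_convex_comb:
  "fiber_point s t ((1 - u) * a + u * b) = (1 - u) *\<^sub>R fiber_point s t a + u *\<^sub>R fiber_point s t b"
  by (simp add: fiber_point_def vec_eq_iff forall_2 algebra_simps)

lemma fiber_point_segment:
  assumes "shear s N = t" "shear s M = t"
  shows "fiber_point s t y \<in> closed_segment N M \<longleftrightarrow> y \<in> closed_segment (N $ 2) (M $ 2)"
    and "N \<noteq> M \<Longrightarrow> fiber_point s t y \<in> open_segment N M \<longleftrightarrow> y \<in> open_segment (N $ 2) (M $ 2)"
proof -
  have *: "fiber_point s t y = (1 - u) *\<^sub>R N + u *\<^sub>R M \<longleftrightarrow> y = (1 - u) * N $ 2 + u * M $ 2" for u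
  proof
    assume "fiber_point s t y = (1 - u) *\<^sub>R N + u *\<^sub>R M"
    then have "fiber_point s t y $ 2 = ((1 - u) *\<^sub>R N + u *\<^sub>R M) $ 2" by simp
    then show "y = (1 - u) * N $ 2 + u * M $ 2" by simp
  next
    assume "y = (1 - u) * N $ 2 + u * M $ 2"
    then show "fiber_point s t y = (1 - u) *\<^sub>R N + u *\<^sub>R M"
      by (simp only: fiber_point_convex_comb fiber_point_shear[OF assms(1)] fiber_point_shear[OF assms(2)])
  qed
  show "fiber_point s t y \<in> closed_segment N M \<longleftrightarrow> y \<in> closed_segment (N $ 2) (M $ 2)"
    by (simp add: in_segment *)
  assume "N \<noteq> M"
  moreover from this have "N $ 2 \<noteq> M $ 2" using fiber_point_shear assms by metis
  ultimately show "fiber_point s t y \<in> open_segment N M \<longleftrightarrow> y \<in> open_segment (N $ 2) (M $ 2)"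
    by (simp add: in_segment *)
qed

text \<open>Shrinking the two sides at \<open>P\<close> by \<open>\<kappa>\<close> and
  \<open>\<mu>\<close> scales the determinant by \<open>\<kappa> * \<mu>\<close>, and the small
  triangle has its third side on the fibre. The resulting identity links orientation to the vertical
  order of the cut points.\<close>

lemma triangle_section_apex:
  fixes P Q R :: "real ^ 2" and s t :: real
  defines "X \<equiv> shear s"
  assumes nc: "\<not> collinear {P, Q, R}"
    and l: "0 < \<kappa>" "\<kappa> < 1" "0 < \<mu>" "\<mu> < 1" and t: "t \<noteq> X P"
    and eq: "\<kappa> * (X Q - X P) = t - X P" "\<mu> * (X R - X P) = t - X P"
  defines "N \<equiv> P + \<kappa> *\<^sub>R (Q - P)" and "M \<equiv> P + \<mu> *\<^sub>R (R - P)"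
  shows "fiber_point s t y \<in> convex hull {P, Q, R} \<longleftrightarrow> y \<in> closed_segment (N $ 2) (M $ 2)"
    "y \<in> open_segment (N $ 2) (M $ 2) \<Longrightarrow> fiber_point s t y \<in> interior (convex hull {P, Q, R})"
    "N $ 2 \<noteq> M $ 2" "\<kappa> * \<mu> * det3 P Q R = (t - X P) * (M $ 2 - N $ 2)"
proof -
  note F = fiber_triangle[OF linear_shear nc l t[unfolded X_def] eq[unfolded X_def],
      folded N_def M_def]
  show "fiber_point s t y \<in> convex hull {P, Q, R} \<longleftrightarrow> y \<in> closed_segment (N $ 2) (M $ 2)"
    using F(4)[of "fiber_point s t y"] fiber_point_segment(1)[OF F(1,2)] by simp
  show "y \<in> open_segment (N $ 2) (M $ 2) \<Longrightarrow> fiber_point s t y \<in> interior (convex hull {P, Q, R})"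
    using F(5)[of "fiber_point s t y"] fiber_point_segment(2)[OF F(1,2,3)] by simp
  show "N $ 2 \<noteq> M $ 2" using F(1-3) fiber_point_shear by metis
  have "\<kappa> * \<mu> * det3 P Q R = det3 P N M"
    by (simp add: det3_def N_def M_def algebra_simps)
  also have "\<dots> = (t - X P) * (M $ 2 - N $ 2)"
  proof -
    have *: "N $ 1 = t - s * N $ 2" "M $ 1 = t - s * M $ 2"
      using F(1,2) by (simp_all add: shear_def)
    show ?thesis unfolding det3_def * by (simp add: X_def shear_def algebra_simps)
  qed
  finally show "\<kappa> * \<mu> * det3 P Q R = (t - X P) * (M $ 2 - N $ 2)" .
qed

text \<open>The apex is \<open>P\<close> or \<open>R\<close>, according to the side of
  \<open>X Q\<close> on which the line passes. The sign statement says that the orientation is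
  positive exactly if the long edge \<open>P R\<close> runs above the path
  \<open>P Q R\<close>.\<close>

lemma triangle_section:
  fixes P Q R :: "real ^ 2" and s t :: real
  defines "X \<equiv> shear s"
  assumes nc: "\<not> collinear {P, Q, R}"
    and X: "X P < X Q" "X Q < X R" and t: "X P < t" "t < X R" "t \<noteq> X Q"
  defines "M \<equiv> edge_at X P R t"
    and "N \<equiv> (if t < X Q then edge_at X P Q t else edge_at X Q R t)"
  shows "fiber_point s t y \<in> convex hull {P, Q, R} \<longleftrightarrow> y \<in> closed_segment (N $ 2) (M $ 2)"
    "y \<in> open_segment (N $ 2) (M $ 2) \<Longrightarrow> fiber_point s t y \<in> interior (convex hull {P, Q, R})"
    "N $ 2 \<noteq> M $ 2" "sgn (det3 P Q R) = sgn (M $ 2 - N $ 2)"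
proof -
  have "(fiber_point s t y \<in> convex hull {P, Q, R} \<longleftrightarrow> y \<in> closed_segment (N $ 2) (M $ 2)) \<and>
    (y \<in> open_segment (N $ 2) (M $ 2) \<longrightarrow> fiber_point s t y \<in> interior (convex hull {P, Q, R})) \<and>
    N $ 2 \<noteq> M $ 2 \<and> sgn (det3 P Q R) = sgn (M $ 2 - N $ 2)"
  proof (cases "t < X Q")
    case True
    define \<kappa> \<mu> where "\<kappa> = (t - X P) / (X Q - X P)" and "\<mu> = (t - X P) / (X R - X P)"
    have km: "0 < \<kappa>" "\<kappa> < 1" "0 < \<mu>" "\<mu> < 1" "t \<noteq> X P"
      "\<kappa> * (X Q - X P) = t - X P" "\<mu> * (X R - X P) = t - X P"
      using X t True by (auto simp: \<kappa>_def \<mu>_def)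
    have NM: "N = P + \<kappa> *\<^sub>R (Q - P)" "M = P + \<mu> *\<^sub>R (R - P)"
      using True by (simp_all add: N_def M_def edge_at_def \<kappa>_def \<mu>_def)
    note T = triangle_section_apex[OF nc km[unfolded X_def], folded X_def, folded NM]
    have "sgn (\<kappa> * \<mu> * det3 P Q R) = sgn ((t - X P) * (M $ 2 - N $ 2))" by (simp only: T(4))
    then have "sgn (det3 P Q R) = sgn (M $ 2 - N $ 2)" using km(1,3) t(1) by (simp add: sgn_mult)
    with T(1,2)[of y] T(3) show ?thesis by blast
  next
    case False
    define \<kappa> \<mu> where "\<kappa> = (t - X R) / (X Q - X R)" and "\<mu> = (t - X R) / (X P - X R)"
    have km: "0 < \<kappa>" "\<kappa> < 1" "0 < \<mu>" "\<mu> < 1" "t \<noteq> X R"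
      "\<kappa> * (X Q - X R) = t - X R" "\<mu> * (X P - X R) = t - X R"
      using X t False by (auto simp: \<kappa>_def \<mu>_def zero_less_divide_iff divide_less_eq)
    have NM: "N = R + \<kappa> *\<^sub>R (Q - R)" "M = R + \<mu> *\<^sub>R (P - R)"
      using False X edge_at_commute[of X Q R t] edge_at_commute[of X P R t]
      by (simp_all add: N_def M_def edge_at_def \<kappa>_def \<mu>_def)
    have perm: "{R, Q, P} = {P, Q, R}" by auto
    have "\<not> collinear {R, Q, P}" using nc by (simp add: perm)
    note T = triangle_section_apex[OF this km[unfolded X_def], folded X_def, folded NM, unfolded perm]
    \<comment> \<open>Exchanging \<open>P\<close> and \<open>R\<close> reverses the orientation, and
      \<open>t - X R\<close> is negative; the two signs cancel.\<close>
    have "det3 R Q P = - det3 P Q R" by (simp add: det3_def algebra_simps)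
    then have "sgn (\<kappa> * \<mu> * det3 P Q R) = sgn ((X R - t) * (M $ 2 - N $ 2))"
      using T(4) by (simp add: algebra_simps)
    then have "sgn (det3 P Q R) = sgn (M $ 2 - N $ 2)" using km(1,3) t(2) by (simp add: sgn_mult)
    with T(1,2)[of y] T(3) show ?thesis by blast
  qed
  then show "fiber_point s t y \<in> convex hull {P, Q, R} \<longleftrightarrow> y \<in> closed_segment (N $ 2) (M $ 2)"
    "y \<in> open_segment (N $ 2) (M $ 2) \<Longrightarrow> fiber_point s t y \<in> interior (convex hull {P, Q, R})"
    "N $ 2 \<noteq> M $ 2" "sgn (det3 P Q R) = sgn (M $ 2 - N $ 2)"
    by blast+
qed

section \<open>Boundary sums over dissections\<close>

text \<open>The point \<open>q\<close> may lie anywhere on the line, not only between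
  \<open>p\<close> and \<open>r\<close>; coinciding points then give \<open>\<phi> p p = 0\<close>
  and antisymmetry.\<close>

definition line_additive :: "(real ^ 2 \<Rightarrow> real ^ 2 \<Rightarrow> real) \<Rightarrow> bool" where
  "line_additive \<phi> \<longleftrightarrow> (\<forall>p q r. collinear {p, q, r} \<longrightarrow> \<phi> p q + \<phi> q r = \<phi> p r)"

text \<open>The integral of \<open>\<phi>\<close> along the counterclockwise boundary. For
  line-additive \<open>\<phi>\<close> the orientation sign makes it independent of the order of the
  vertices.\<close>

definition boundary_sum :: "(real ^ 2 \<Rightarrow> real ^ 2 \<Rightarrow> real) \<Rightarrow> real ^ 2 \<Rightarrow> real ^ 2 \<Rightarrow> real ^ 2 \<Rightarrow> real" where
  "boundary_sum \<phi> p q r = sgn (det3 p q r) * (\<phi> p q + \<phi> q r + \<phi> r p)"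

lemma line_additive_same: "line_additive \<phi> \<Longrightarrow> \<phi> p p = 0"
  unfolding line_additive_def by (metis add_cancel_left_left collinear_2 insert_absorb2)

lemma line_additive_minus:
  assumes "line_additive \<phi>"
  shows "\<phi> q p = - \<phi> p q"
proof -
  have "\<phi> p q + \<phi> q p = \<phi> p p"
    using assms unfolding line_additive_def by (metis collinear_2 insert_absorb2 insert_commute)
  then show ?thesis using line_additive_same[OF assms] by simp
qed

lemma shear_convex_hull_bounds:
  assumes "z \<in> convex hull {P, Q, R}" "shear s P < shear s Q" "shear s Q < shear s R"
  shows "shear s P \<le> shear s z" "shear s z \<le> shear s R"
proof -
  have "convex hull {P, Q, R} \<subseteq> shear s -` {shear s P..shear s R}"
    using assms by (intro hull_minimal convex_linear_vimage linear_shear) auto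
  then show "shear s P \<le> shear s z" "shear s z \<le> shear s R" using assms(1) by auto
qed

lemma telescope_line_additive:
  assumes "line_additive \<phi>" "X u \<noteq> X v" "a \<le> b"
  shows "(\<Sum>j=a..<b. \<phi> (edge_at X u v (ts ! j)) (edge_at X u v (ts ! Suc j))) =
    \<phi> (edge_at X u v (ts ! a)) (edge_at X u v (ts ! b))"
  using assms(3)
proof (induction rule: dec_induct)
  case base
  then show ?case by (simp add: line_additive_same[OF assms(1)])
next
  case (step b)
  then show ?case
    using assms(1) collinear_edge_at by (simp add: line_additive_def)
qed

text \<open>
  The lines \<open>X = const\<close> through all vertices and all crossings of edge lines cut the plane into
  slabs. Within one slab the edges of a dissection are linearly ordered, and the contributions of
  the two triangles on either side of an edge cancel, so only the outer boundary survives.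
\<close>

lemma boundary_sum_sorted:
  fixes I J :: "'i set" and P Q R :: "'i \<Rightarrow> real ^ 2"
  assumes fin: "finite I" "finite J" and add: "line_additive \<phi>"
    and sorted: "\<And>i. i \<in> I \<union> J \<Longrightarrow> shear s (P i) < shear s (Q i) \<and> shear s (Q i) < shear s (R i)"
    and nc: "\<And>i. i \<in> I \<union> J \<Longrightarrow> \<not> collinear {P i, Q i, R i}"
    and disj: "\<And>A i j. A \<in> {I, J} \<Longrightarrow> i \<in> A \<Longrightarrow> j \<in> A \<Longrightarrow> i \<noteq> j \<Longrightarrow>
      interior (convex hull {P i, Q i, R i}) \<inter> interior (convex hull {P j, Q j, R j}) = {}"
    and un: "\<And>A. A \<in> {I, J} \<Longrightarrow> (\<Union>i\<in>A. convex hull {P i, Q i, R i}) = K" and K: "convex K"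
  shows "(\<Sum>i\<in>I. boundary_sum \<phi> (P i) (Q i) (R i)) = (\<Sum>i\<in>J. boundary_sum \<phi> (P i) (Q i) (R i))"
proof -
  define X where "X = shear s"
  \<comment> \<open>The edges of both dissections together, because the slabs and the function
    \<open>F\<close> below have to be common to the two.\<close>
  define W where "W = (\<Union>i\<in>I \<union> J. {(P i, Q i), (Q i, R i), (P i, R i)})"
  define crossing where "crossing e = {t. edge_at X (fst (fst e)) (snd (fst e)) t = edge_at X (fst (snd e)) (snd (snd e)) t}" for e
  define Crit where "Crit = X ` (fst ` W \<union> snd ` W) \<union>
    (\<Union>e\<in>{e\<in>W \<times> W. edge_at X (fst (fst e)) (snd (fst e)) \<noteq> edge_at X (fst (snd e)) (snd (snd e))}. crossing e)"
  have finW: "finite W" using fin by (simp add: W_def)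
  have WX: "X u < X v" if "(u, v) \<in> W" for u v
    using that sorted unfolding W_def X_def by (auto intro: less_trans)
  have WI: "(P i, Q i) \<in> W" "(Q i, R i) \<in> W" "(P i, R i) \<in> W" if "i \<in> I \<union> J" for i
    using that by (auto simp: W_def)
  have "finite (crossing e)" if "edge_at X (fst (fst e)) (snd (fst e)) \<noteq> edge_at X (fst (snd e)) (snd (snd e))" for e
  proof -
    have "\<exists>a. crossing e \<subseteq> {a}"
      using that edge_at_eqI unfolding crossing_def by blast
    then show ?thesis using finite_subset by blast
  qed
  then have finC: "finite Crit" using finW unfolding Crit_def by auto
  define ts where "ts = sorted_list_of_set Crit"
  define n where "n = length ts"
  have ts: "sorted ts" "distinct ts" "set ts = Crit" using finC by (simp_all add: ts_def)
  have ts_less: "ts ! a < ts ! b" if "a < b" "b < n" for a b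
    using that ts by (metis distinct_conv_nth less_imp_le_nat n_def order.strict_trans
        order_le_less order_less_irrefl sorted_nth_mono)
  have ts_le: "ts ! a \<le> ts ! b \<longleftrightarrow> a \<le> b" if "a < n" "b < n" for a b
    using ts_less[of a b] ts_less[of b a] that by (cases a b rule: linorder_cases) auto
  have Crit_nth: "\<exists>a<n. ts ! a = c" if "c \<in> Crit" for c
    using that ts(3) by (metis in_set_conv_nth n_def)
  have gap: "c \<le> ts ! j \<or> ts ! Suc j \<le> c" if "c \<in> Crit" "Suc j < n" for c j
    using Crit_nth[OF that(1)] ts_le that(2) by (metis Suc_lessD not_less_eq_eq)
  have W_Crit: "X u \<in> Crit" "X v \<in> Crit" if "(u, v) \<in> W" for u v
    using that by (force simp: Crit_def)+
  \<comment> \<open>The increment of \<open>\<phi>\<close> along the part of the edge over slab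
    \<open>j\<close>. Endpoints are critical, so an edge spans a slab or misses its inside, and the
    parts add up to the whole edge.\<close>
  define E where "E j u v = (if X u \<le> ts ! j \<and> ts ! Suc j \<le> X v
      then \<phi> (edge_at X u v (ts ! j)) (edge_at X u v (ts ! Suc j)) else 0)" for j u v
  have sumE: "(\<Sum>j<n - 1. E j u v) = \<phi> u v" if uv: "(u, v) \<in> W" for u v
  proof -
    obtain a b where ab: "a < n" "ts ! a = X u" "b < n" "ts ! b = X v"
      using Crit_nth W_Crit[OF uv] by metis
    then have "a < b" using WX[OF uv] ts_le[of b a] by (simp add: not_le[symmetric])
    have "(\<Sum>j<n - 1. E j u v) = (\<Sum>j=a..<b. E j u v)"
      using ab ts_le by (intro sum.mono_neutral_right) (auto simp: E_def simp flip: ab(2,4))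
    also have "\<dots> = (\<Sum>j=a..<b. \<phi> (edge_at X u v (ts ! j)) (edge_at X u v (ts ! Suc j)))"
      using ab ts_le by (intro sum.cong) (auto simp: E_def simp flip: ab(2,4))
    also have "\<dots> = \<phi> u v"
      using telescope_line_additive[OF add, of X u v a b ts] WX[OF uv] \<open>a < b\<close> ab
      by (simp add: edge_at_endpoints)
    finally show ?thesis .
  qed
  \<comment> \<open>The edge \<open>P R\<close> gets a minus sign: all edges are traversed in the
    direction of increasing \<open>X\<close>, while the boundary returns from \<open>R\<close> to
    \<open>P\<close>.\<close>
  define w where "w j i = sgn (det3 (P i) (Q i) (R i)) * (E j (P i) (Q i) + E j (Q i) (R i) - E j (P i) (R i))"
    for j i
  have bd: "boundary_sum \<phi> (P i) (Q i) (R i) = (\<Sum>j<n - 1. w j i)" if "i \<in> I \<union> J" for i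
    unfolding boundary_sum_def w_def sum_distrib_left[symmetric] sum.distrib sum_subtractf
      sumE[OF WI(1)[OF that]] sumE[OF WI(2)[OF that]] sumE[OF WI(3)[OF that]]
    using line_additive_minus[OF add, of "P i" "R i"] by simp
  \<comment> \<open>One \<open>H\<close> serves both families: it is read off at the extreme heights
    of \<open>K\<close> over the middle line of the slab.\<close>
  have slab: "\<exists>H. \<forall>A\<in>{I, J}. (\<Sum>i\<in>A. w j i) = H" if j: "Suc j < n" for j
  proof -
    define t where "t = (ts ! j + ts ! Suc j) / 2"
    have t: "ts ! j < t" "t < ts ! Suc j" using ts_less[of j "Suc j"] j by (simp_all add: t_def)
    have t_Crit: "t \<notin> Crit" using gap[OF _ j, of t] t by auto
    \<comment> \<open>The increment over the slab of any edge through height \<open>y\<close> of the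
      middle line. The choice is immaterial: edges that meet there lie on one line, since
      \<open>t\<close> is not critical.\<close>
    define F where "F y = (let e = (SOME e. e \<in> W \<and> edge_at X (fst e) (snd e) t = fiber_point s t y)
      in \<phi> (edge_at X (fst e) (snd e) (ts ! j)) (edge_at X (fst e) (snd e) (ts ! Suc j)))" for y
    have F: "F (edge_at X u v t $ 2) = \<phi> (edge_at X u v (ts ! j)) (edge_at X u v (ts ! Suc j))"
      if uv: "(u, v) \<in> W" for u v
    proof -
      define e where "e = (SOME e. e \<in> W \<and> edge_at X (fst e) (snd e) t = fiber_point s t (edge_at X u v t $ 2))"
      have "fiber_point s t (edge_at X u v t $ 2) = edge_at X u v t"
        using WX[OF uv] unfolding X_def by (intro fiber_point_shear linear_edge_at linear_shear) auto
      then have "\<exists>e. e \<in> W \<and> edge_at X (fst e) (snd e) t = fiber_point s t (edge_at X u v t $ 2)"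
        using uv by (intro exI[of _ "(u, v)"]) simp
      from someI_ex[OF this] have e: "e \<in> W" "edge_at X (fst e) (snd e) t = edge_at X u v t"
        using \<open>fiber_point s t (edge_at X u v t $ 2) = edge_at X u v t\<close> by (simp_all add: e_def)
      have "edge_at X (fst e) (snd e) = edge_at X u v"
      proof (rule ccontr)
        assume ne: "edge_at X (fst e) (snd e) \<noteq> edge_at X u v"
        have "t \<in> crossing (e, (u, v))" using e by (simp add: crossing_def)
        then have "t \<in> Crit"
          unfolding Crit_def using ne e uv by (intro UnI2 UN_I[of "(e, (u, v))"]) auto
        with t_Crit show False by simp
      qed
      then show ?thesis unfolding F_def Let_def e_def[symmetric] by simp
    qed
    define U where "U = {y. fiber_point s t y \<in> K}"
    have "(\<Sum>i\<in>A. w j i) = (if U = {} then 0 else F (Inf U) - F (Sup U))" if A: "A \<in> {I, J}" for A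
    proof -
      have AIJ: "A \<subseteq> I \<union> J" and finA: "finite A" using A fin by auto
      define B where "B = {i\<in>A. X (P i) \<le> ts ! j \<and> ts ! Suc j \<le> X (R i)}"
      have finB: "finite B" using finA by (simp add: B_def)
      define M where "M i = edge_at X (P i) (R i) t $ 2" for i
      define N where "N i = (if t < X (Q i) then edge_at X (P i) (Q i) t else edge_at X (Q i) (R i) t) $ 2" for i
      define \<alpha> \<beta> where "\<alpha> i = min (M i) (N i)" and "\<beta> i = max (M i) (N i)" for i
      have inactive: "w j i = 0" "fiber_point s t y \<notin> convex hull {P i, Q i, R i}" if i: "i \<in> A - B" for i y
      proof -
        have iIJ: "i \<in> I \<union> J" using i AIJ by auto
        have PQR: "X (P i) < X (Q i)" "X (Q i) < X (R i)" using sorted[OF iIJ] by (simp_all add: X_def)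
        have "ts ! j < X (P i) \<or> X (R i) < ts ! Suc j" using i by (auto simp: B_def)
        then show "w j i = 0" using PQR by (auto simp: w_def E_def)
        have "t < X (P i) \<or> X (R i) < t"
          using \<open>ts ! j < X (P i) \<or> X (R i) < ts ! Suc j\<close> t
            gap[OF W_Crit(1)[OF WI(1)[OF iIJ]] j] gap[OF W_Crit(2)[OF WI(2)[OF iIJ]] j] by auto
        then show "fiber_point s t y \<notin> convex hull {P i, Q i, R i}"
          using shear_convex_hull_bounds[of "fiber_point s t y" "P i" "Q i" "R i" s] PQR
          by (auto simp: X_def)
      qed
      have active: "fiber_point s t y \<in> convex hull {P i, Q i, R i} \<longleftrightarrow> y \<in> {\<alpha> i..\<beta> i}"
        "y \<in> {\<alpha> i<..<\<beta> i} \<Longrightarrow> fiber_point s t y \<in> interior (convex hull {P i, Q i, R i})"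
        "\<alpha> i < \<beta> i" "w j i = F (\<alpha> i) - F (\<beta> i)" if i: "i \<in> B" for i y
      proof -
        have iIJ: "i \<in> I \<union> J" using i AIJ by (auto simp: B_def)
        have PQR: "X (P i) < X (Q i)" "X (Q i) < X (R i)" using sorted[OF iIJ] by (simp_all add: X_def)
        have span: "X (P i) \<le> ts ! j" "ts ! Suc j \<le> X (R i)" using i by (auto simp: B_def)
        have tt: "X (P i) < t" "t < X (R i)" using span t by auto
        have Qgap: "X (Q i) \<le> ts ! j \<or> ts ! Suc j \<le> X (Q i)"
          by (rule gap[OF W_Crit(1)[OF WI(2)[OF iIJ]] j])
        then have tQ: "t \<noteq> X (Q i)" using t by auto
        note T = triangle_section[OF nc[OF iIJ] PQR[unfolded X_def] tt[unfolded X_def] tQ[unfolded X_def],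
            folded X_def, folded M_def N_def]
        show "fiber_point s t y \<in> convex hull {P i, Q i, R i} \<longleftrightarrow> y \<in> {\<alpha> i..\<beta> i}"
          using T(1)[of y] by (auto simp: \<alpha>_def \<beta>_def closed_segment_eq_real_ivl)
        show "y \<in> {\<alpha> i<..<\<beta> i} \<Longrightarrow> fiber_point s t y \<in> interior (convex hull {P i, Q i, R i})"
          using T(2)[of y] by (cases "N i \<le> M i") (auto simp: \<alpha>_def \<beta>_def open_segment_eq_real_ivl)
        show "\<alpha> i < \<beta> i" using T(3) by (auto simp: \<alpha>_def \<beta>_def)
        have "E j (P i) (Q i) + E j (Q i) (R i) = F (N i)"
          using Qgap t span PQR F[OF WI(1)[OF iIJ]] F[OF WI(2)[OF iIJ]]
          by (auto simp: E_def N_def)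
        moreover have "E j (P i) (R i) = F (M i)"
          using span F[OF WI(3)[OF iIJ]] by (simp add: E_def M_def)
        \<comment> \<open>The orientation tells which cut point is the upper one, so each triangle
          contributes \<open>F\<close> at its lower end minus \<open>F\<close> at its upper
          end.\<close>
        ultimately have "w j i = sgn (M i - N i) * (F (N i) - F (M i))"
          using T(4) by (simp add: w_def)
        then show "w j i = F (\<alpha> i) - F (\<beta> i)"
          using T(3) by (auto simp: \<alpha>_def \<beta>_def sgn_if min_def max_def)
      qed
      have Ueq: "U = (\<Union>i\<in>B. {\<alpha> i..\<beta> i})"
      proof -
        have "U = {y. \<exists>i\<in>A. fiber_point s t y \<in> convex hull {P i, Q i, R i}}"
          using un[OF A] unfolding U_def by blast
        also have "\<dots> = {y. \<exists>i\<in>B. fiber_point s t y \<in> convex hull {P i, Q i, R i}}"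
          using inactive(2) unfolding B_def by blast
        also have "\<dots> = (\<Union>i\<in>B. {\<alpha> i..\<beta> i})" using active(1) by blast
        finally show ?thesis .
      qed
      have sumB: "(\<Sum>i\<in>A. w j i) = (\<Sum>i\<in>B. F (\<alpha> i) - F (\<beta> i))"
        using finA inactive(1) active(4) by (intro sum.mono_neutral_cong_right) (auto simp: B_def)
      show ?thesis
      proof (cases "B = {}")
        case True
        then show ?thesis using sumB Ueq by simp
      next
        case False
        then obtain i where i: "i \<in> B" by auto
        have "compact U" unfolding Ueq using finB by (intro compact_UN) auto
        \<comment> \<open>Convexity of \<open>K\<close> makes the section a single interval, which
          the sections of the triangles tile without gaps.\<close>
        moreover have "convex U"
        proof (rule convexI)
          fix x y u v :: real assume h: "x \<in> U" "y \<in> U" "0 \<le> u" "0 \<le> v" "u + v = 1"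
          then have "u = 1 - v" by simp
          then show "u *\<^sub>R x + v *\<^sub>R y \<in> U"
            using h convexD[OF K, of "fiber_point s t x" "fiber_point s t y" u v]
            unfolding \<open>u = 1 - v\<close> U_def by (simp add: fiber_point_convex_comb)
        qed
        ultimately obtain l h where lh: "U = {l..h}"
          using connected_compact_interval_1 convex_connected by blast
        have "{\<alpha> i..\<beta> i} \<subseteq> {l..h}" using Ueq lh i by blast
        then have "l < h" using active(3)[OF i] by auto
        have "(\<Sum>i\<in>B. F (\<alpha> i) - F (\<beta> i)) = F l - F h"
        proof (rule interval_sum_telescope[OF finB active(3) \<open>l < h\<close>])
          show "(\<Union>i\<in>B. {\<alpha> i..\<beta> i}) = {l..h}" using Ueq lh by simp
          show "{\<alpha> i<..<\<beta> i} \<inter> {\<alpha> k<..<\<beta> k} = {}" if ik: "i \<in> B" "k \<in> B" "i \<noteq> k" for i k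
            using active(2)[OF ik(1)] active(2)[OF ik(2)] disj[OF A, of i k] ik
            unfolding B_def by blast
        qed
        then show ?thesis using sumB lh \<open>l < h\<close> by simp
      qed
    qed
    then show ?thesis by blast
  qed
  have "(\<Sum>i\<in>I. boundary_sum \<phi> (P i) (Q i) (R i)) = (\<Sum>j<n - 1. \<Sum>i\<in>I. w j i)"
    by (subst sum.swap) (simp add: bd)
  also have "\<dots> = (\<Sum>j<n - 1. \<Sum>i\<in>J. w j i)"
  proof (rule sum.cong[OF refl])
    fix j assume "j \<in> {..<n - 1}"
    then show "(\<Sum>i\<in>I. w j i) = (\<Sum>i\<in>J. w j i)" using slab[of j] by auto
  qed
  also have "\<dots> = (\<Sum>i\<in>J. boundary_sum \<phi> (P i) (Q i) (R i))"
    by (subst sum.swap) (simp add: bd)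
  finally show ?thesis .
qed

section \<open>Orientation, and triangles in general position\<close>

lemma collinear_iff_det3: "collinear {p, q, r} \<longleftrightarrow> det3 p q r = 0"
proof -
  define x y where "x = q - p" and "y = r - p"
  have "collinear {p, q, r} \<longleftrightarrow> collinear {0, x, y}"
    using collinear_3[of q p r] by (simp add: x_def y_def insert_commute)
  also have "\<dots> \<longleftrightarrow> x $ 1 * y $ 2 - y $ 1 * x $ 2 = 0"
  proof
    assume "collinear {0, x, y}"
    then show "x $ 1 * y $ 2 - y $ 1 * x $ 2 = 0" by (auto simp: collinear_lemma)
  next
    assume *: "x $ 1 * y $ 2 - y $ 1 * x $ 2 = 0"
    consider "x = 0" | "x $ 1 \<noteq> 0" | "x $ 2 \<noteq> 0" by (auto simp: vec_eq_iff forall_2)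
    then show "collinear {0, x, y}"
    proof cases
      case 1 then show ?thesis by (simp add: collinear_lemma)
    next
      case 2
      then have "y = (y $ 1 / x $ 1) *\<^sub>R x" using * by (simp add: vec_eq_iff forall_2 field_simps)
      then show ?thesis unfolding collinear_lemma by blast
    next
      case 3
      then have "y = (y $ 2 / x $ 2) *\<^sub>R x" using * by (simp add: vec_eq_iff forall_2 field_simps)
      then show ?thesis unfolding collinear_lemma by blast
    qed
  qed
  finally show ?thesis by (simp add: det3_def x_def y_def)
qed

lemma det3_rotate: "det3 q r p = det3 p q r"
  by (simp add: det3_def algebra_simps)

lemma det3_swap: "det3 q p r = - det3 p q r"
  by (simp add: det3_def algebra_simps)

text \<open>A transposition of vertices changes both the orientation sign and the sign of the cyclic
  sum, so boundary sums survive sorting.\<close>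

lemma sort_triangle:
  assumes add: "line_additive \<phi>" and ne: "X a \<noteq> X b" "X b \<noteq> X c" "X a \<noteq> (X c :: real)"
  shows "\<exists>P Q R. {P, Q, R} = {a, b, c} \<and> X P < X Q \<and> X Q < X R \<and>
    boundary_sum \<phi> P Q R = boundary_sum \<phi> a b c"
proof -
  have rot: "boundary_sum \<phi> q r p = boundary_sum \<phi> p q r" for p q r
    by (simp add: boundary_sum_def det3_rotate[of q r p])
  have swap: "boundary_sum \<phi> q p r = boundary_sum \<phi> p q r" for p q r
    by (simp add: boundary_sum_def det3_swap[of q p r] sgn_minus line_additive_minus[OF add, of p q]
        line_additive_minus[OF add, of r p] line_additive_minus[OF add, of q r] algebra_simps)
  consider "X a < X b" "X b < X c" | "X a < X c" "X c < X b" | "X b < X a" "X a < X c"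
    | "X b < X c" "X c < X a" | "X c < X a" "X a < X b" | "X c < X b" "X b < X a"
    using ne by linarith
  then show ?thesis
  proof cases
    case 1 then show ?thesis by blast
  next
    case 2
    moreover have "boundary_sum \<phi> a c b = boundary_sum \<phi> a b c" by (metis rot swap)
    moreover have "{a, c, b} = {a, b, c}" by auto
    ultimately show ?thesis by blast
  next
    case 3
    moreover have "boundary_sum \<phi> b a c = boundary_sum \<phi> a b c" by (metis rot swap)
    moreover have "{b, a, c} = {a, b, c}" by auto
    ultimately show ?thesis by blast
  next
    case 4
    moreover have "boundary_sum \<phi> b c a = boundary_sum \<phi> a b c" by (metis rot swap)
    moreover have "{b, c, a} = {a, b, c}" by auto
    ultimately show ?thesis by blast
  next
    case 5
    moreover have "boundary_sum \<phi> c a b = boundary_sum \<phi> a b c" by (metis rot swap)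
    moreover have "{c, a, b} = {a, b, c}" by auto
    ultimately show ?thesis by blast
  next
    case 6
    moreover have "boundary_sum \<phi> c b a = boundary_sum \<phi> a b c" by (metis rot swap)
    moreover have "{c, b, a} = {a, b, c}" by auto
    ultimately show ?thesis by blast
  qed
qed

text \<open>Points of different height share an abscissa for one value of \<open>s\<close> only,
  distinct points of equal height for none.\<close>

lemma exists_generic_shear:
  assumes "finite W"
  shows "\<exists>s. inj_on (shear s) W"
proof -
  \<comment> \<open>For pairs of equal height the quotient is 0 by the convention for division,
    which merely excludes one more value.\<close>
  define bad where "bad = (\<lambda>(p :: real ^ 2, q). (q $ 1 - p $ 1) / (p $ 2 - q $ 2)) ` (W \<times> W)"
  have "finite bad" using assms by (simp add: bad_def)
  then obtain s where s: "s \<notin> bad" using ex_new_if_finite infinite_UNIV_char_0 by blast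
  have "p = q" if pq: "p \<in> W" "q \<in> W" "shear s p = shear s q" for p q
  proof (cases "p $ 2 = q $ 2")
    case True
    then show ?thesis using pq(3) by (simp add: shear_def vec_eq_iff forall_2)
  next
    case False
    have "s * (p $ 2 - q $ 2) = q $ 1 - p $ 1" using pq(3) by (simp add: shear_def algebra_simps)
    then have "s = (q $ 1 - p $ 1) / (p $ 2 - q $ 2)" using False by (simp add: field_simps)
    then have "s \<in> bad" using pq(1,2) unfolding bad_def by (intro image_eqI[of _ _ "(p, q)"]) auto
    with s show ?thesis by simp
  qed
  then show ?thesis by (intro exI[of _ s] inj_onI)
qed

text \<open>Stokes for dissections, phrased as independence of the dissection so that the boundary
  of \<open>K\<close> needs no description. A generic shear reduces it to triangles with sorted
  vertices.\<close>

lemma boundary_sum_dissections: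
  fixes I J :: "'i set" and A B C :: "'i \<Rightarrow> real ^ 2"
  assumes fin: "finite I" "finite J" and add: "line_additive \<phi>"
    and nc: "\<And>i. i \<in> I \<union> J \<Longrightarrow> \<not> collinear {A i, B i, C i}"
    and disj: "\<And>H i j. H \<in> {I, J} \<Longrightarrow> i \<in> H \<Longrightarrow> j \<in> H \<Longrightarrow> i \<noteq> j \<Longrightarrow>
      interior (convex hull {A i, B i, C i}) \<inter> interior (convex hull {A j, B j, C j}) = {}"
    and un: "\<And>H. H \<in> {I, J} \<Longrightarrow> (\<Union>i\<in>H. convex hull {A i, B i, C i}) = K" and K: "convex K"
  shows "(\<Sum>i\<in>I. boundary_sum \<phi> (A i) (B i) (C i)) = (\<Sum>i\<in>J. boundary_sum \<phi> (A i) (B i) (C i))"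
proof -
  define W where "W = (\<Union>i\<in>I \<union> J. {A i, B i, C i})"
  have "finite W" using fin by (simp add: W_def)
  then obtain s where s: "inj_on (shear s) W" using exists_generic_shear by blast
  have ex: "\<exists>P Q R. {P, Q, R} = {A i, B i, C i} \<and> shear s P < shear s Q \<and> shear s Q < shear s R \<and>
    boundary_sum \<phi> P Q R = boundary_sum \<phi> (A i) (B i) (C i)" if i: "i \<in> I \<union> J" for i
  proof (rule sort_triangle[OF add])
    have W: "A i \<in> W" "B i \<in> W" "C i \<in> W" using i by (auto simp: W_def)
    have ne: "A i \<noteq> B i" "B i \<noteq> C i" "A i \<noteq> C i"
      using nc[OF i] by (auto simp: insert_commute)
    show "shear s (A i) \<noteq> shear s (B i)" "shear s (B i) \<noteq> shear s (C i)" "shear s (A i) \<noteq> shear s (C i)"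
      using W ne s by (auto dest: inj_onD)
  qed
  then obtain P Q R where PQR: "\<And>i. i \<in> I \<union> J \<Longrightarrow> {P i, Q i, R i} = {A i, B i, C i}"
    "\<And>i. i \<in> I \<union> J \<Longrightarrow> shear s (P i) < shear s (Q i) \<and> shear s (Q i) < shear s (R i)"
    "\<And>i. i \<in> I \<union> J \<Longrightarrow> boundary_sum \<phi> (P i) (Q i) (R i) = boundary_sum \<phi> (A i) (B i) (C i)"
    by metis
  have "(\<Sum>i\<in>I. boundary_sum \<phi> (P i) (Q i) (R i)) = (\<Sum>i\<in>J. boundary_sum \<phi> (P i) (Q i) (R i))"
  proof (rule boundary_sum_sorted[OF fin add PQR(2) _ _ _ K])
    show "\<not> collinear {P i, Q i, R i}" if "i \<in> I \<union> J" for i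
      using nc[OF that] PQR(1)[OF that] by simp
    show "interior (convex hull {P i, Q i, R i}) \<inter> interior (convex hull {P j, Q j, R j}) = {}"
      if "H \<in> {I, J}" "i \<in> H" "j \<in> H" "i \<noteq> j" for H i j
      using disj[OF that] PQR(1)[of i] PQR(1)[of j] that by auto
    show "(\<Union>i\<in>H. convex hull {P i, Q i, R i}) = K" if H: "H \<in> {I, J}" for H
    proof -
      have "(\<Union>i\<in>H. convex hull {P i, Q i, R i}) = (\<Union>i\<in>H. convex hull {A i, B i, C i})"
        using H PQR(1) by (intro SUP_cong refl arg_cong[of _ _ "(hull) convex"]) auto
      then show ?thesis using un[OF H] by simp
    qed
  qed auto
  then show ?thesis using PQR(3) by simp
qed

section \<open>The parallelogram and its two halves\<close>

lemma parallelogram_split: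
  fixes p u v :: "'a::real_vector"
  shows "convex hull {p, p + u, p + u + v, p + v} =
    convex hull {p, p + u, p + u + v} \<union> convex hull {p, p + u + v, p + v}"
proof
  define S where "S = {p + a *\<^sub>R u + b *\<^sub>R v | a b. 0 \<le> a \<and> a \<le> 1 \<and> 0 \<le> b \<and> b \<le> 1}"
  have inS: "p + a *\<^sub>R u + b *\<^sub>R v \<in> S" if "0 \<le> a" "a \<le> 1" "0 \<le> b" "b \<le> 1" for a b
    using that unfolding S_def by blast
  have "convex S"
  proof (rule convexI)
    fix x y \<mu> \<nu> assume "x \<in> S" "y \<in> S" and w: "0 \<le> \<mu>" "0 \<le> \<nu>" "\<mu> + \<nu> = (1 :: real)"
    then obtain a b c d where xy: "x = p + a *\<^sub>R u + b *\<^sub>R v" "y = p + c *\<^sub>R u + d *\<^sub>R v"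
      "0 \<le> a" "a \<le> 1" "0 \<le> b" "b \<le> 1" "0 \<le> c" "c \<le> 1" "0 \<le> d" "d \<le> 1"
      unfolding S_def by blast
    have n: "\<nu> = 1 - \<mu>" using w by simp
    have "\<mu> *\<^sub>R x + \<nu> *\<^sub>R y = p + (\<mu> * a + \<nu> * c) *\<^sub>R u + (\<mu> * b + \<nu> * d) *\<^sub>R v"
      unfolding xy n by (simp add: algebra_simps)
    then show "\<mu> *\<^sub>R x + \<nu> *\<^sub>R y \<in> S" using inS xy w by (simp add: convex_bound_le)
  qed
  moreover have "p \<in> S" "p + u \<in> S" "p + u + v \<in> S" "p + v \<in> S"
    using inS[of 0 0] inS[of 1 0] inS[of 1 1] inS[of 0 1] by simp_all
  ultimately have "convex hull {p, p + u, p + u + v, p + v} \<subseteq> S"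
    by (intro hull_minimal) auto
  also have "S \<subseteq> convex hull {p, p + u, p + u + v} \<union> convex hull {p, p + u + v, p + v}"
  proof
    fix z assume "z \<in> S"
    then obtain a b where z: "z = p + a *\<^sub>R u + b *\<^sub>R v" "0 \<le> a" "a \<le> 1" "0 \<le> b" "b \<le> 1"
      unfolding S_def by blast
    show "z \<in> convex hull {p, p + u, p + u + v} \<union> convex hull {p, p + u + v, p + v}"
    proof (cases "b \<le> a")
      case True
      then have "z \<in> convex hull {p, p + u, p + u + v}"
        unfolding convex_hull_3_alt using z
        by (intro CollectI exI[of _ "a - b"] exI[of _ b]) (auto simp: algebra_simps)
      then show ?thesis by simp
    next
      case False
      then have "z \<in> convex hull {p, p + u + v, p + v}"
        unfolding convex_hull_3_alt using z
        by (intro CollectI exI[of _ a] exI[of _ "b - a"]) (auto simp: algebra_simps)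
      then show ?thesis by simp
    qed
  qed
  finally show "convex hull {p, p + u, p + u + v, p + v} \<subseteq>
    convex hull {p, p + u, p + u + v} \<union> convex hull {p, p + u + v, p + v}" .
  show "convex hull {p, p + u, p + u + v} \<union> convex hull {p, p + u + v, p + v} \<subseteq>
    convex hull {p, p + u, p + u + v, p + v}"
    by (intro Un_least hull_mono) auto
qed

lemma parallelogram_halves:
  assumes nc: "\<not> collinear {0, u, v :: real ^ 2}"
  shows "det3 p (p + u) (p + u + v) = det3 0 u v" "det3 p (p + u + v) (p + v) = det3 0 u v"
    "interior (convex hull {p, p + u, p + u + v}) \<inter> interior (convex hull {p, p + u + v, p + v}) = {}"
proof -
  show 1: "det3 p (p + u) (p + u + v) = det3 0 u v" and 2: "det3 p (p + u + v) (p + v) = det3 0 u v"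
    by (simp_all add: det3_def algebra_simps)
  have D: "det3 0 u v \<noteq> 0" using nc by (simp add: collinear_iff_det3)
  have nc12: "\<not> collinear {p, p + u, p + u + v}" "\<not> collinear {p, p + u + v, p + v}"
    unfolding collinear_iff_det3 1 2 using D by simp_all
  have dim: "DIM(real ^ 2) = 2" by simp
  \<comment> \<open>For \<open>z = p + a u + b v\<close> this is
    \<open>(a - b) * det3 0 u v\<close>, which changes sign across the common diagonal.\<close>
  define g where "g z = det3 p z (p + v) - det3 p (p + u) z" for z
  show "interior (convex hull {p, p + u, p + u + v}) \<inter> interior (convex hull {p, p + u + v, p + v}) = {}"
  proof (rule ccontr)
    assume "\<not> ?thesis"
    then obtain z where z: "z \<in> interior (convex hull {p, p + u, p + u + v})"
      "z \<in> interior (convex hull {p, p + u + v, p + v})" by blast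
    obtain x y w where 1: "0 < y" "x + y + w = 1" "z = x *\<^sub>R p + y *\<^sub>R (p + u) + w *\<^sub>R (p + u + v)"
      using z(1) unfolding interior_convex_hull_3_minimal[OF nc12(1) dim] by blast
    obtain x' y' w' where 2: "0 < w'" "x' + y' + w' = 1" "z = x' *\<^sub>R p + y' *\<^sub>R (p + u + v) + w' *\<^sub>R (p + v)"
      using z(2) unfolding interior_convex_hull_3_minimal[OF nc12(2) dim] by blast
    have x: "x = 1 - y - w" "x' = 1 - y' - w'" using 1(2) 2(2) by simp_all
    have "g z = y * det3 0 u v"
      unfolding 1(3) x by (simp add: g_def det3_def algebra_simps)
    moreover have "g z = - w' * det3 0 u v"
      unfolding 2(3) x by (simp add: g_def det3_def algebra_simps)
    ultimately have "(y + w') * det3 0 u v = 0" by (simp add: distrib_right)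
    then show False using D 1(1) 2(1) by simp
  qed
qed

text \<open>Comparison with the dissection into two halves, whose contributions along the diagonal
  cancel.\<close>

lemma parallelogram_boundary_sum:
  fixes A B C :: "nat \<Rightarrow> real ^ 2"
  assumes add: "line_additive \<phi>" and uv: "\<not> collinear {0, u, v}"
    and nc: "\<And>i. i \<in> {1..n} \<Longrightarrow> \<not> collinear {A i, B i, C i}"
    and disj: "\<And>i j. i \<in> {1..n} \<Longrightarrow> j \<in> {1..n} \<Longrightarrow> i \<noteq> j \<Longrightarrow>
      interior (convex hull {A i, B i, C i}) \<inter> interior (convex hull {A j, B j, C j}) = {}"
    and un: "(\<Union>i\<in>{1..n}. convex hull {A i, B i, C i}) = convex hull {p, p + u, p + u + v, p + v}"
  shows "(\<Sum>i\<in>{1..n}. boundary_sum \<phi> (A i) (B i) (C i)) =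
    sgn (det3 0 u v) * (\<phi> p (p + u) + \<phi> (p + u) (p + u + v) + \<phi> (p + u + v) (p + v) + \<phi> (p + v) p)"
proof -
  \<comment> \<open>The indices \<open>0\<close> and \<open>Suc n\<close> lie outside
    \<open>{1..n}\<close> and carry the two halves, so that one family of vertices describes both
    dissections.\<close>
  define ext :: "(nat \<Rightarrow> real ^ 2) \<Rightarrow> real ^ 2 \<Rightarrow> real ^ 2 \<Rightarrow> nat \<Rightarrow> real ^ 2" where
    "ext A x y i = (if i = 0 then x else if i = Suc n then y else A i)" for A x y i
  define A' where "A' = ext A p p"
  define B' where "B' = ext B (p + u) (p + u + v)"
  define C' where "C' = ext C (p + u + v) (p + v)"
  have old: "A' i = A i" "B' i = B i" "C' i = C i" if "i \<in> {1..n}" for i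
    using that by (auto simp: A'_def B'_def C'_def ext_def)
  have new: "A' 0 = p" "B' 0 = p + u" "C' 0 = p + u + v"
    "A' (Suc n) = p" "B' (Suc n) = p + u + v" "C' (Suc n) = p + v"
    by (simp_all add: A'_def B'_def C'_def ext_def)
  note halves = parallelogram_halves[OF uv, of p]
  have D: "det3 0 u v \<noteq> 0" using uv by (simp add: collinear_iff_det3)
  have "(\<Sum>i\<in>{1..n}. boundary_sum \<phi> (A i) (B i) (C i)) = (\<Sum>i\<in>{1..n}. boundary_sum \<phi> (A' i) (B' i) (C' i))"
    by (intro sum.cong) (simp_all add: old)
  also have "\<dots> = (\<Sum>i\<in>{0, Suc n}. boundary_sum \<phi> (A' i) (B' i) (C' i))"
  proof (rule boundary_sum_dissections[OF _ _ add])
    show "\<not> collinear {A' i, B' i, C' i}" if "i \<in> {1..n} \<union> {0, Suc n}" for i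
      using that
    proof
      assume "i \<in> {0, Suc n}"
      then show ?thesis using halves(1,2) D new unfolding collinear_iff_det3 by auto
    qed (use nc old in simp)
    show "interior (convex hull {A' i, B' i, C' i}) \<inter> interior (convex hull {A' j, B' j, C' j}) = {}"
      if H: "H \<in> {{1..n}, {0, Suc n}}" and ij: "i \<in> H" "j \<in> H" "i \<noteq> j" for H i j
    proof (cases "H = {1..n}")
      case True
      then show ?thesis using disj ij old by simp
    next
      case False
      then have "H = {0, Suc n}" using H by blast
      then have "i = 0 \<and> j = Suc n \<or> i = Suc n \<and> j = 0" using ij by auto
      then show ?thesis using halves(3) new by (auto simp: Int_commute)
    qed
    show "(\<Union>i\<in>H. convex hull {A' i, B' i, C' i}) = convex hull {p, p + u, p + u + v, p + v}"
      if H: "H \<in> {{1..n}, {0, Suc n}}" for H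
    proof (cases "H = {1..n}")
      case True
      then show ?thesis using un old by simp
    next
      case False
      then have "H = {0, Suc n}" using H by blast
      then show ?thesis using new parallelogram_split[of p u v] by simp
    qed
  qed (auto simp: convex_convex_hull)
  also have "\<dots> = boundary_sum \<phi> p (p + u) (p + u + v) + boundary_sum \<phi> p (p + u + v) (p + v)"
    using new by simp
  also have "\<dots> = sgn (det3 0 u v) * (\<phi> p (p + u) + \<phi> (p + u) (p + u + v) + \<phi> (p + u + v) (p + v) + \<phi> (p + v) p)"
    unfolding boundary_sum_def halves(1,2)
    using line_additive_minus[OF add, of p "p + u + v"] by (simp add: algebra_simps)
  finally show ?thesis .
qed

section \<open>Colouring by a valuation ring\<close>

text \<open>Membership in the maximal ideal when \<open>V\<close> is a valuation ring. Zero is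
  listed separately because \<open>inverse 0 = 0\<close> belongs to \<open>V\<close>.\<close>

definition small :: "'a::field set \<Rightarrow> 'a \<Rightarrow> bool" where
  "small V x \<longleftrightarrow> x = 0 \<or> inverse x \<notin> V"

text \<open>
  Modulo the maximal ideal, \<open>[1 : x : y]\<close> is a point of the projective plane over the residue
  field. Colour 0 is a point of that plane, colours 0 and 2 together are a line through it, and
  colour 1 is the rest.
\<close>

definition colour :: "'a::field set \<Rightarrow> 'a \<Rightarrow> 'a \<Rightarrow> nat" where
  "colour V x y = (if \<not> small V x \<and> y / x \<in> V then 1 else if \<not> small V y then 2 else 0)"

lemma colour_cases: "colour V x y = 0 \<or> colour V x y = 1 \<or> colour V x y = 2"
  by (simp add: colour_def)

context
  fixes V :: "'a::field set"
  assumes V: "valuation_ring V"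
begin

private lemma V_sub: "is_subring V"
  using V by (simp add: valuation_ring_def)

private lemmas VD = subringD[OF V_sub]

lemma small_in: "small V x \<Longrightarrow> x \<in> V"
  using V VD by (auto simp: valuation_ring_def small_def)

lemma not_small_1: "\<not> small V 1"
  using VD by (simp add: small_def)

lemma small_mult:
  assumes "small V x" "y \<in> V"
  shows "small V (x * y)"
proof (rule ccontr)
  assume "\<not> small V (x * y)"
  then have "x \<noteq> 0" "y \<noteq> 0" "inverse (x * y) \<in> V" by (auto simp: small_def)
  then have "y * inverse (x * y) \<in> V" using VD(6)[OF assms(2)] by simp
  also have "y * inverse (x * y) = inverse x" using \<open>y \<noteq> 0\<close> by (simp add: field_simps)
  finally show False using assms(1) \<open>x \<noteq> 0\<close> by (simp add: small_def)
qed

lemma small_minus: "small V (- x) \<longleftrightarrow> small V x"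
  using VD(3)[of "inverse x"] VD(3)[of "- inverse x"] by (auto simp: small_def)

text \<open>One of \<open>x / y\<close> and \<open>y / x\<close> lies in \<open>V\<close>, so the
  sum is one of the summands times an element of \<open>V\<close>.\<close>

lemma small_add:
  assumes "small V x" "small V y"
  shows "small V (x + y)"
proof -
  have *: "small V (x + y)" if "small V x" "small V y" "x / y \<in> V" "y \<noteq> 0" for x y
  proof -
    have "x + y = y * (1 + x / y)" using \<open>y \<noteq> 0\<close> by (simp add: field_simps)
    moreover have "1 + x / y \<in> V" using VD that by blast
    ultimately show ?thesis using small_mult that by metis
  qed
  have "x / y \<in> V \<or> y / x \<in> V"
    using V unfolding valuation_ring_def by (metis inverse_divide)
  then show ?thesis
    using *[of x y] *[of y x] assms by (cases "x = 0"; cases "y = 0") (auto simp: add.commute)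
qed

lemma small_diff: "small V x \<Longrightarrow> small V y \<Longrightarrow> small V (x - y)"
  using small_add[of x "- y"] small_minus[of y] by simp

lemma not_small_mult: "\<not> small V x \<Longrightarrow> \<not> small V y \<Longrightarrow> \<not> small V (x * y)"
  using VD by (auto simp: small_def)

lemma not_small_1_diff: "small V x \<Longrightarrow> \<not> small V (1 - x)"
  using small_add[of x "1 - x"] not_small_1 by auto

lemma colour_0D:
  assumes "colour V x y = 0"
  shows "small V x" "small V y"
proof -
  show y: "small V y" using assms by (auto simp: colour_def split: if_splits)
  show "small V x"
  proof (rule ccontr)
    assume x: "\<not> small V x"
    then have "y * inverse x \<in> V" using VD(6)[OF small_in[OF y]] by (auto simp: small_def)
    then show False using assms x by (simp add: colour_def divide_inverse)
  qed
qed

lemma colour_1D: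
  assumes "colour V x y = 1"
  shows "\<not> small V x" "y / x \<in> V"
  using assms by (auto simp: colour_def split: if_splits)

lemma colour_2D:
  assumes "colour V x y = 2"
  shows "\<not> small V y" "small V (x / y)"
proof -
  show y: "\<not> small V y" using assms by (auto simp: colour_def split: if_splits)
  show "small V (x / y)"
  proof (cases "small V x")
    case True
    then show ?thesis using small_mult[OF True, of "inverse y"] y
      by (simp add: small_def divide_inverse)
  next
    case False
    then have "y / x \<notin> V" using assms by (auto simp: colour_def split: if_splits)
    then show ?thesis by (simp add: small_def)
  qed
qed

text \<open>Dividing by the dominant product \<open>b1 * c2\<close> leaves
  \<open>(1 - \<alpha>) * (1 - \<beta>) - \<gamma> * \<delta>\<close>, which is 1 modulo the maximal
  ideal: \<open>\<delta>\<close> may be a unit, but its factor \<open>\<gamma>\<close> is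
  small.\<close>

lemma rainbow_determinant_not_small:
  assumes a: "colour V a1 a2 = 0" and b: "colour V b1 b2 = 1" and c: "colour V c1 c2 = 2"
  shows "\<not> small V ((b1 - a1) * (c2 - a2) - (c1 - a1) * (b2 - a2))"
proof -
  note a = colour_0D[OF a] and b = colour_1D[OF b] and c = colour_2D[OF c]
  have b1: "b1 \<noteq> 0" "inverse b1 \<in> V" and c2: "c2 \<noteq> 0" "inverse c2 \<in> V"
    using b(1) c(1) by (auto simp: small_def)
  define \<alpha> where "\<alpha> = a1 / b1"
  define \<beta> where "\<beta> = a2 / c2"
  define \<gamma> where "\<gamma> = c1 / c2 - a1 / c2"
  define \<delta> where "\<delta> = b2 / b1 - a2 / b1"
  have \<alpha>: "small V \<alpha>" unfolding \<alpha>_def divide_inverse by (intro small_mult a b1)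
  have \<beta>: "small V \<beta>" unfolding \<beta>_def divide_inverse by (intro small_mult a c2)
  have "small V (a1 * inverse c2)" by (intro small_mult a c2)
  then have \<gamma>: "small V \<gamma>" unfolding \<gamma>_def by (intro small_diff c(2)) (simp add: divide_inverse)
  have "small V (a2 * inverse b1)" by (intro small_mult a b1)
  then have \<delta>: "\<delta> \<in> V" unfolding \<delta>_def by (intro VD b(2)) (simp add: divide_inverse small_in)
  have s: "small V (\<alpha> + \<beta> - \<alpha> * \<beta> + \<gamma> * \<delta>)"
    using \<alpha> \<beta> small_mult[OF \<alpha> small_in[OF \<beta>]] small_mult[OF \<gamma> \<delta>]
    by (intro small_add small_diff)
  have "(b1 - a1) * (c2 - a2) - (c1 - a1) * (b2 - a2) = b1 * c2 * (1 - (\<alpha> + \<beta> - \<alpha> * \<beta> + \<gamma> * \<delta>))"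
    using b1(1) c2(1) by (simp add: \<alpha>_def \<beta>_def \<gamma>_def \<delta>_def field_simps)
  then show ?thesis
    using not_small_mult[OF not_small_mult[OF b(1) c(1)] not_small_1_diff[OF s]] by simp
qed

end

section \<open>Affine coordinates in the parallelogram, by Cramer's rule\<close>

definition coord1 :: "real ^ 2 \<Rightarrow> real ^ 2 \<Rightarrow> real ^ 2 \<Rightarrow> real ^ 2 \<Rightarrow> real" where
  "coord1 p u v z = det3 p z (p + v) / det3 0 u v"

definition coord2 :: "real ^ 2 \<Rightarrow> real ^ 2 \<Rightarrow> real ^ 2 \<Rightarrow> real ^ 2 \<Rightarrow> real" where
  "coord2 p u v z = det3 p (p + u) z / det3 0 u v"

lemma coord_corners:
  assumes "det3 0 u v \<noteq> 0"
  shows "coord1 p u v p = 0" "coord1 p u v (p + u) = 1" "coord1 p u v (p + u + v) = 1" "coord1 p u v (p + v) = 0"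
    "coord2 p u v p = 0" "coord2 p u v (p + u) = 0" "coord2 p u v (p + u + v) = 1" "coord2 p u v (p + v) = 1"
  using assms by (simp_all add: coord1_def coord2_def det3_def algebra_simps)

text \<open>Moving the origin to a neighbouring corner reverses one edge vector; two such flips
  reach the opposite corner. Thus a statement about the corner \<open>p\<close> serves all
  four.\<close>

lemma coord_flip:
  assumes "det3 0 u v \<noteq> 0"
  shows "coord1 (p + u) (- u) v z = 1 - coord1 p u v z" "coord2 (p + u) (- u) v z = coord2 p u v z"
    "coord1 (p + v) u (- v) z = coord1 p u v z" "coord2 (p + v) u (- v) z = 1 - coord2 p u v z"
proof -
  have D: "det3 0 (- u) v = - det3 0 u v" "det3 0 u (- v) = - det3 0 u v"
    by (simp_all add: det3_def)
  have "det3 (p + u) z (p + u + v) = det3 p z (p + v) - det3 0 u v"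
    "det3 (p + u) p z = - det3 p (p + u) z" "det3 (p + v) z p = - det3 p z (p + v)"
    "det3 (p + v) (p + v + u) z = det3 p (p + u) z - det3 0 u v"
    by (simp_all add: det3_def algebra_simps)
  then show "coord1 (p + u) (- u) v z = 1 - coord1 p u v z" "coord2 (p + u) (- u) v z = coord2 p u v z"
    "coord1 (p + v) u (- v) z = coord1 p u v z" "coord2 (p + v) u (- v) z = 1 - coord2 p u v z"
    using assms by (simp_all add: coord1_def coord2_def D diff_divide_distrib)
qed

lemma det3_coord:
  assumes "det3 0 u v \<noteq> 0"
  shows "det3 a b c / det3 0 u v =
    (coord1 p u v b - coord1 p u v a) * (coord2 p u v c - coord2 p u v a)
    - (coord1 p u v c - coord1 p u v a) * (coord2 p u v b - coord2 p u v a)"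
proof -
  have "det3 a b c * det3 0 u v =
    (det3 p b (p + v) - det3 p a (p + v)) * (det3 p (p + u) c - det3 p (p + u) a)
    - (det3 p c (p + v) - det3 p a (p + v)) * (det3 p (p + u) b - det3 p (p + u) a)"
    by (simp add: det3_def algebra_simps)
  then have "det3 a b c / det3 0 u v =
    ((det3 p b (p + v) - det3 p a (p + v)) * (det3 p (p + u) c - det3 p (p + u) a)
    - (det3 p c (p + v) - det3 p a (p + v)) * (det3 p (p + u) b - det3 p (p + u) a))
    / (det3 0 u v * det3 0 u v)"
    using assms by (metis mult_divide_mult_cancel_right)
  then show ?thesis
    unfolding coord1_def coord2_def by (simp add: diff_divide_distrib flip: diff_divide_distrib)
qed

text \<open>Reordering the vertices changes the determinant only by a sign, which does not affect
  smallness. Applied to a zero determinant, this says that every line misses a colour.\<close>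

lemma rainbow_triangle:
  fixes V :: "real set" and p :: "real ^ 2" and c :: "real ^ 2 \<Rightarrow> nat"
  assumes V: "valuation_ring V" and D: "det3 0 u v \<noteq> 0"
  defines "c \<equiv> \<lambda>z. colour V (coord1 p u v z) (coord2 p u v z)"
  assumes rainbow: "{c x, c y, c z} = {0, 1, 2}"
  shows "\<not> small V (det3 x y z / det3 0 u v)"
proof -
  define N where "N x y z \<longleftrightarrow> \<not> small V (det3 x y z / det3 0 u v)" for x y z
  have N: "N x y z" if "c x = 0" "c y = 1" "c z = 2" for x y z
    unfolding N_def det3_coord[OF D, of x y z p]
    using that by (intro rainbow_determinant_not_small[OF V]) (simp_all add: c_def)
  have rot: "N y z x \<longleftrightarrow> N x y z" for x y z
    by (simp add: N_def det3_rotate[of y z x])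
  have swap: "N y x z \<longleftrightarrow> N x y z" for x y z
    by (simp add: N_def det3_swap[of y x z] small_minus[OF V])
  note perm = N[of x y z] N[of y z x] N[of z x y] N[of y x z] N[of x z y] N[of z y x]
  have N_eq: "N y z x = N x y z" "N z x y = N x y z" "N y x z = N x y z" "N x z y = N x y z" "N z y x = N x y z"
    using rot[of x y z] rot[of y z x] swap[of x y z] swap[of z x y] swap[of y z x] by simp_all
  have "0 \<in> {c x, c y, c z}" "1 \<in> {c x, c y, c z}" "2 \<in> {c x, c y, c z}"
    using rainbow by simp_all
  then have "N x y z"
    unfolding insert_iff empty_iff using perm[unfolded N_eq] by (elim disjE) simp_all
  then show ?thesis by (simp add: N_def)
qed

text \<open>A nonzero sum around the parallelogram forces a triangle with nonzero boundary sum.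
  Around a triangle that lacks a colour, changes from 0 to 1 and from 1 to 0 cancel, so this
  triangle is rainbow; its vertex of colour 0 is the one congruent to the corner
  \<open>p\<close>.\<close>

lemma dissection_rainbow:
  fixes A B C :: "nat \<Rightarrow> real ^ 2" and V :: "real set"
  assumes V: "valuation_ring V" and uv: "\<not> collinear {0, u, v}"
    and nc: "\<And>i. i \<in> {1..n} \<Longrightarrow> \<not> collinear {A i, B i, C i}"
    and disj: "\<And>i j. i \<in> {1..n} \<Longrightarrow> j \<in> {1..n} \<Longrightarrow> i \<noteq> j \<Longrightarrow>
      interior (convex hull {A i, B i, C i}) \<inter> interior (convex hull {A j, B j, C j}) = {}"
    and un: "(\<Union>i\<in>{1..n}. convex hull {A i, B i, C i}) = convex hull {p, p + u, p + u + v, p + v}"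
  shows "\<exists>i\<in>{1..n}. \<not> small V (det3 (A i) (B i) (C i) / det3 0 u v) \<and>
    (\<exists>z\<in>{A i, B i, C i}. small V (coord1 p u v z) \<and> small V (coord2 p u v z))"
proof -
  have D: "det3 0 u v \<noteq> 0" using uv by (simp add: collinear_iff_det3)
  define c where "c z = colour V (coord1 p u v z) (coord2 p u v z)" for z
  have c_cases: "c z = 0 \<or> c z = 1 \<or> c z = 2" for z
    using colour_cases unfolding c_def by blast
  \<comment> \<open>On colours 0 and 1 this is the difference of colours, and it vanishes once
    colour 2 is involved; additivity can fail only on triples that show all three colours.\<close>
  define \<phi> :: "real ^ 2 \<Rightarrow> real ^ 2 \<Rightarrow> real" where
    "\<phi> x y = (if c x = 0 \<and> c y = 1 then 1 else if c x = 1 \<and> c y = 0 then - 1 else 0)" for x y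
  have small_0: "small V 0" by (simp add: small_def)
  have "line_additive \<phi>"
    unfolding line_additive_def
  proof (intro allI impI)
    fix x y z :: "real ^ 2" assume "collinear {x, y, z}"
    then have "det3 x y z = 0" by (simp add: collinear_iff_det3)
    then have "{c x, c y, c z} \<noteq> {0, 1, 2}"
      using rainbow_triangle[OF V D, of p x y z] small_0 by (auto simp: c_def)
    then show "\<phi> x y + \<phi> y z = \<phi> x z"
      using c_cases[of x] c_cases[of y] c_cases[of z]
      by (elim disjE) (simp_all add: \<phi>_def insert_commute)
  qed
  note S = parallelogram_boundary_sum[OF this uv nc disj un]
  have V0: "0 \<in> V" "1 \<in> V" using V subringD by (auto simp: valuation_ring_def)
  then have "c p = 0" "c (p + u) = 1" "c (p + u + v) = 1" "c (p + v) = 2"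
    using not_small_1[OF V] small_0 by (simp_all add: c_def coord_corners[OF D] colour_def)
  \<comment> \<open>Only the edge from \<open>p\<close> to \<open>p + u\<close> changes between
    colours 0 and 1.\<close>
  then have "\<phi> p (p + u) + \<phi> (p + u) (p + u + v) + \<phi> (p + u + v) (p + v) + \<phi> (p + v) p = 1"
    by (simp add: \<phi>_def)
  then have "(\<Sum>i\<in>{1..n}. boundary_sum \<phi> (A i) (B i) (C i)) \<noteq> 0"
    using S D by (simp add: sgn_eq_0_iff)
  then obtain i where i: "i \<in> {1..n}" "boundary_sum \<phi> (A i) (B i) (C i) \<noteq> 0"
    by (meson sum.neutral)
  then have "\<phi> (A i) (B i) + \<phi> (B i) (C i) + \<phi> (C i) (A i) \<noteq> 0"
    by (auto simp: boundary_sum_def)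
  then have R: "{c (A i), c (B i), c (C i)} = {0, 1, 2}"
    using c_cases[of "A i"] c_cases[of "B i"] c_cases[of "C i"]
    by (elim disjE) (simp_all add: \<phi>_def insert_commute)
  then have "\<not> small V (det3 (A i) (B i) (C i) / det3 0 u v)"
    using rainbow_triangle[OF V D, of p "A i" "B i" "C i"] by (simp add: c_def)
  moreover have "0 \<in> c ` {A i, B i, C i}" using R by simp
  then obtain z where "z \<in> {A i, B i, C i}" "c z = 0" by (metis imageE)
  then have "\<exists>z\<in>{A i, B i, C i}. small V (coord1 p u v z) \<and> small V (coord2 p u v z)"
    using colour_0D[OF V] unfolding c_def by blast
  ultimately show ?thesis using i(1) by blast
qed

text \<open>For the cross product, the boundary sum of a triangle is twice its area, and the circuit
  of the parallelogram gives twice \<open>det3 0 u v\<close>; additivity of area is thus another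
  instance of the same identity.\<close>

lemma dissection_area_sum:
  fixes A B C :: "nat \<Rightarrow> real ^ 2"
  assumes uv: "\<not> collinear {0, u, v}"
    and nc: "\<And>i. i \<in> {1..n} \<Longrightarrow> \<not> collinear {A i, B i, C i}"
    and disj: "\<And>i j. i \<in> {1..n} \<Longrightarrow> j \<in> {1..n} \<Longrightarrow> i \<noteq> j \<Longrightarrow>
      interior (convex hull {A i, B i, C i}) \<inter> interior (convex hull {A j, B j, C j}) = {}"
    and un: "(\<Union>i\<in>{1..n}. convex hull {A i, B i, C i}) = convex hull {p, p + u, p + u + v, p + v}"
  shows "(\<Sum>i\<in>{1..n}. \<bar>det3 (A i) (B i) (C i)\<bar>) = 2 * \<bar>det3 0 u v\<bar>"
proof -
  define \<phi> where "\<phi> x y = x $ 1 * y $ 2 - y $ 1 * x $ 2" for x y :: "real ^ 2"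
  have \<phi>: "\<phi> x y + \<phi> y z + \<phi> z x = det3 x y z" for x y z
    by (simp add: \<phi>_def det3_def algebra_simps)
  have "line_additive \<phi>"
    unfolding line_additive_def collinear_iff_det3
  proof (intro allI impI)
    fix x y z assume "det3 x y z = 0"
    moreover have "\<phi> z x = - \<phi> x z" by (simp add: \<phi>_def)
    ultimately show "\<phi> x y + \<phi> y z = \<phi> x z" using \<phi>[of x y z] by linarith
  qed
  note S = parallelogram_boundary_sum[OF this uv nc disj un]
  have "boundary_sum \<phi> x y z = \<bar>det3 x y z\<bar>" for x y z
    unfolding boundary_sum_def \<phi> by (simp add: abs_sgn mult.commute)
  moreover have "\<phi> p (p + u) + \<phi> (p + u) (p + u + v) + \<phi> (p + u + v) (p + v) + \<phi> (p + v) p = 2 * det3 0 u v"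
    by (simp add: \<phi>_def det3_def algebra_simps)
  ultimately show ?thesis using S by (simp add: abs_sgn mult.commute)
qed

section \<open>Integrality of the last area\<close>

theorem theorem2:
  fixes T :: "(real ^ 2) set" and n :: nat
    and t :: "nat \<Rightarrow> (real ^ 2) set" and a :: "nat \<Rightarrow> real"
  assumes "is_parallelogram T"
    and "dissection T n t"
    and "\<And>i. i \<in> {1..n} \<Longrightarrow> a i = area (t i)"
  shows "integral_over (subring_generated (a ` {1..<n})) (a n)"
proof (rule ccontr)
  assume not_int: "\<not> ?thesis"
  define R where "R = subring_generated (a ` {1..<n})"
  have inter: "is_subring (\<Inter>\<F>)" if "\<And>S. S \<in> \<F> \<Longrightarrow> is_subring S" for \<F> :: "real set set"
    unfolding is_subring_def using subringD(1,4,6)[OF that] by simp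
  have R: "is_subring R"
    unfolding R_def subring_generated_def by (rule hull_in) (simp add: inter)
  have "\<not> integral_over R (a n)" using not_int by (simp add: R_def)
  then obtain V where V: "valuation_ring V" "R \<subseteq> V" "a n \<notin> V"
    by (rule exists_valuation_ring[OF R])
  have Vsub: "is_subring V" using V(1) by (simp add: valuation_ring_def)
  note VD = subringD[OF Vsub]
  have aV: "a i \<in> V" if "i \<in> {1..<n}" for i
    using V(2) that unfolding R_def subring_generated_def
    by (meson hull_subset image_eqI subsetD)
  obtain p u v where uv: "\<not> collinear {0, u, v}" and T: "T = convex hull {p, p + u, p + u + v, p + v}"
    using assms(1) unfolding is_parallelogram_def by blast
  have tri: "\<exists>x y z. \<not> collinear {x, y, z} \<and> t i = convex hull {x, y, z}" if "i \<in> {1..n}" for i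
    using assms(2) that unfolding dissection_def is_triangle_def by blast
  then obtain A B C where nc: "\<And>i. i \<in> {1..n} \<Longrightarrow> \<not> collinear {A i, B i, C i}"
    and t: "\<And>i. i \<in> {1..n} \<Longrightarrow> t i = convex hull {A i, B i, C i}"
    by metis
  have disj: "interior (convex hull {A i, B i, C i}) \<inter> interior (convex hull {A j, B j, C j}) = {}"
    if "i \<in> {1..n}" "j \<in> {1..n}" "i \<noteq> j" for i j
    using assms(2) that unfolding dissection_def by (simp flip: t)
  have un: "(\<Union>i\<in>{1..n}. convex hull {A i, B i, C i}) = T"
    using assms(2) unfolding dissection_def by (simp flip: t)
  define D where "D = det3 0 u v"
  have D: "D \<noteq> 0" using uv by (simp add: D_def collinear_iff_det3)
  have a: "\<bar>det3 (A i) (B i) (C i)\<bar> = 2 * a i" if "i \<in> {1..n}" for i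
  proof -
    have "compact (convex hull {A i, B i, C i})"
      by (simp add: finite_imp_compact_convex_hull)
    then have "measure lebesgue (convex hull {A i, B i, C i}) = measure lborel (convex hull {A i, B i, C i})"
      by (intro measure_completion) (simp add: borel_compact)
    then show ?thesis
      using assms(3)[OF that] t[OF that] unfolding area_def content_triangle
      by (simp add: det3_def abs_minus_commute)
  qed
  have "(\<Sum>i\<in>{1..n}. 2 * a i) = 2 * \<bar>D\<bar>"
    using dissection_area_sum[OF uv nc disj un[unfolded T]] a by (simp add: D_def)
  then have sum_a: "(\<Sum>i\<in>{1..n}. a i) = \<bar>D\<bar>" by (simp flip: sum_distrib_left)
  have "n \<ge> 1" using sum_a D by (cases n) auto
  then have "(\<Sum>i\<in>{1..n}. a i) = a n + (\<Sum>i\<in>{1..<n}. a i)"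
    by (metis add.commute atLeastLessThanSuc_atLeastAtMost sum.atLeastLessThan_Suc)
  then have "a n = \<bar>D\<bar> - (\<Sum>i\<in>{1..<n}. a i)" using sum_a by simp
  moreover have "(\<Sum>i\<in>{1..<n}. a i) \<in> V" by (intro subring_sum[OF Vsub] aV)
  ultimately have "\<bar>D\<bar> \<notin> V" using V(3) VD(4) by metis
  then have invD: "small V (inverse \<bar>D\<bar>)" by (simp add: small_def)
  have small_i: "small V (det3 (A i) (B i) (C i) / D)" if i: "i \<in> {1..<n}" for i
  proof -
    \<comment> \<open>The determinant is twice the area; writing the double as
      \<open>a i + a i\<close> keeps it in \<open>V\<close>.\<close>
    have "small V (inverse \<bar>D\<bar> * (a i + a i))"
      by (intro small_mult[OF V(1) invD] VD aV i)
    also have "inverse \<bar>D\<bar> * (a i + a i) = \<bar>det3 (A i) (B i) (C i) / D\<bar>"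
      using a[of i] i by (simp add: abs_mult divide_inverse mult.commute)
    finally show ?thesis using small_minus[OF V(1)] by (auto simp: abs_if split: if_splits)
  qed
  \<comment> \<open>The pair \<open>q\<close> names a corner: each component tells whether the
    corresponding coordinate is measured from the opposite side.\<close>
  define near where "near q z \<longleftrightarrow> small V (if fst q then 1 - coord1 p u v z else coord1 p u v z) \<and>
    small V (if snd q then 1 - coord2 p u v z else coord2 p u v z)" for q z
  have corner: "\<exists>z\<in>{A n, B n, C n}. near q z" for q
  proof -
    \<comment> \<open>The same parallelogram, described with corner \<open>q\<close> as
      origin.\<close>
    define u' where "u' = (if fst q then - u else u)"
    define v' where "v' = (if snd q then - v else v)"
    define p' where "p' = p + (if fst q then u else 0) + (if snd q then v else 0)"
    have det': "det3 0 u' v' = D \<or> det3 0 u' v' = - D"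
      by (auto simp: D_def u'_def v'_def det3_def)
    then have uv': "\<not> collinear {0, u', v'}" using D by (auto simp: collinear_iff_det3)
    have "{p', p' + u', p' + u' + v', p' + v'} = {p, p + u, p + u + v, p + v}"
      by (auto simp: p'_def u'_def v'_def algebra_simps)
    then have un': "(\<Union>i\<in>{1..n}. convex hull {A i, B i, C i}) = convex hull {p', p' + u', p' + u' + v', p' + v'}"
      using un T by simp
    have Dv: "det3 0 (- u) v \<noteq> 0" "det3 0 u v \<noteq> 0" using D by (simp_all add: D_def det3_def)
    have coord: "coord1 p' u' v' z = (if fst q then 1 - coord1 p u v z else coord1 p u v z)"
      "coord2 p' u' v' z = (if snd q then 1 - coord2 p u v z else coord2 p u v z)" for z
      unfolding p'_def u'_def v'_def using Dv by (simp_all add: coord_flip)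
    obtain i where i: "i \<in> {1..n}" "\<not> small V (det3 (A i) (B i) (C i) / det3 0 u' v')"
      and z: "\<exists>z\<in>{A i, B i, C i}. small V (coord1 p' u' v' z) \<and> small V (coord2 p' u' v' z)"
      using dissection_rainbow[OF V(1) uv' nc disj un'] by blast
    have "\<not> small V (det3 (A i) (B i) (C i) / D)"
      using i(2) det' small_minus[OF V(1), of "det3 (A i) (B i) (C i) / D"] by auto
    then have "i = n" using small_i[of i] i(1) by force
    then show ?thesis using z unfolding near_def coord by simp
  qed
  then obtain f where f: "f q \<in> {A n, B n, C n}" "near q (f q)" for q by metis
  \<comment> \<open>A point near two corners would have a coordinate \<open>x\<close> with
    \<open>x\<close> and \<open>1 - x\<close> both small, although they add up to 1.\<close>
  have "\<not> (small V x \<and> small V (1 - x))" for x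
    using not_small_1_diff[OF V(1)] by blast
  then have "q = q'" if "near q z" "near q' z" for q q' z
    using that unfolding near_def by (intro prod_eqI) (metis (full_types))+
  then have "inj f" using f(2) by (intro injI) metis
  moreover have "range f \<subseteq> {A n, B n, C n}" using f(1) by blast
  ultimately have "card (UNIV :: (bool \<times> bool) set) \<le> card {A n, B n, C n}"
    by (intro card_inj_on_le) auto
  also have "\<dots> \<le> 3" by (simp add: card_insert_if)
  finally show False by (simp flip: UNIV_Times_UNIV add: card_cartesian_product)
qed

end
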